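(* Let $0<\alpha<1$ and $b_1,b_2\in\mathbb{R}$. Let $f:[0,\infty)\times\mathbb{R}\to\mathbb{R}$ be continuous and such that $f(\cdot,x(\cdot))\in C_{1-\alpha}[0,\infty)$ for every $x\in AC[0,\infty)$. Suppose there are continuous functions $P,\varphi:[0,\infty)\to[0,\infty)$ such that $$|f(\tau,x)|\le \varphi(|x|)\,P(\tau)\quad\text{for all }\tau\ge 0,\ x\in\mathbb{R},\qquad \int_1^\infty s^\alpha P(s)\,ds<\infty,$$ and $\varphi\in\Phi$. Let $x\in AC[0,\infty)$ be a solution, in the space $C^{\alpha,1}_{1-\alpha}[0,\infty)$, of $$\left({}^C\mathfrak{D}_0^{\alpha}x\right)'(\tau)=f(\tau,x(\tau)),\quad \tau>0,\qquad x(0)=b_1,\qquad {}^C\mathfrak{D}_0^{\alpha}x(\tau)\big|_{\tau=0}=b_2 .$$ Then there exists $a\in\mathbb{R}$ such that $$\lim_{\tau\to\infty}\frac{x(\tau)}{\tau^\alpha}=a .$$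
   Context: $AC[0,\infty)$ denotes the functions $x:[0,\infty)\to\mathbb{R}$ that are absolutely continuous on every compact interval $[0,T]$. For $0\le\eta<1$, $C_\eta[0,\infty)$ is the set of functions $h:(0,\infty)\to\mathbb{R}$ such that $\tau\mapsto \tau^\eta h(\tau)$ is continuous on $[0,\infty)$ (i.e. is continuous on $(0,\infty)$ and extends continuously to $0$). For $\mu>0$ the Riemann-Liouville fractional integral is $\mathfrak{I}_0^\mu g(\tau)=\frac{1}{\Gamma(\mu)}\int_0^\tau (\tau-s)^{\mu-1}g(s)\,ds$, $\tau>0$. For $0<\alpha<1$ the Caputo fractional derivative is ${}^C\mathfrak{D}_0^\alpha x(\tau)=\mathfrak{I}_0^{1-\alpha}x'(\tau)$, $\tau>0$; its value at $\tau=0$ is understood as the limit as $\tau\to0^+$. $C^{\alpha,1}_{1-\alpha}[0,\infty)=\{x\in AC[0,\infty): ({}^C\mathfrak{D}_0^\alpha x)'\in C_{1-\alpha}[0,\infty)\}$. $\Phi$ is the class of functions $\varphi$, continuous on $(0,\infty)$, that are nondecreasing and positive on $(0,\infty)$ and satisfy $\frac1v\varphi(w)\le\varphi\left(\frac wv\right)$ for all $w>0$, $v\ge1$. *)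

theory Defs
  imports "HOL-Analysis.Analysis"
begin

text \<open>
  Functions on \<open>[0,\<infinity>)\<close> or \<open>(0,\<infinity>)\<close> are represented by total functions on the reals;
  no definition below depends on the values outside the intended domain.
\<close>

definition abs_cont_on :: "real set \<Rightarrow> (real \<Rightarrow> real) \<Rightarrow> bool" where
  "abs_cont_on S x \<longleftrightarrow>
    (\<forall>\<epsilon>>0. \<exists>\<delta>>0. \<forall>(n::nat) a b.
       (\<forall>i<n. a i \<le> b i \<and> {a i..b i} \<subseteq> S) \<and>
       disjoint_family_on (\<lambda>i. {a i<..<b i}) {..<n} \<and>
       (\<Sum>i<n. b i - a i) < \<delta>
       \<longrightarrow> (\<Sum>i<n. \<bar>x (b i) - x (a i)\<bar>) < \<epsilon>)"

definition AC_halfline :: "(real \<Rightarrow> real) set" where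
  "AC_halfline = {x. \<forall>T>0. abs_cont_on {0..T} x}"

text \<open>
  The continuous extension to \<open>0\<close> is expressed by the existence of the right-hand limit:
  in Isabelle \<open>0 powr \<eta> * h 0 = 0\<close>, so continuity of the total function
  on \<open>[0,\<infinity>)\<close> would force the limit to be \<open>0\<close>.
\<close>
definition C_weighted :: "real \<Rightarrow> (real \<Rightarrow> real) set" where
  "C_weighted \<eta> =
    {h. continuous_on {0<..} (\<lambda>\<tau>. \<tau> powr \<eta> * h \<tau>) \<and>
        (\<exists>L. ((\<lambda>\<tau>. \<tau> powr \<eta> * h \<tau>) \<longlongrightarrow> L) (at_right 0))}"

definition RL_exists :: "real \<Rightarrow> (real \<Rightarrow> real) \<Rightarrow> real \<Rightarrow> bool" where
  "RL_exists \<mu> g \<tau> \<longleftrightarrow>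
    set_integrable lebesgue {0..\<tau>} (\<lambda>s. (\<tau> - s) powr (\<mu> - 1) * g s)"

definition RL_integral :: "real \<Rightarrow> (real \<Rightarrow> real) \<Rightarrow> real \<Rightarrow> real" where
  "RL_integral \<mu> g \<tau> =
    1 / Gamma \<mu> * (LINT s:{0..\<tau>}|lebesgue. (\<tau> - s) powr (\<mu> - 1) * g s)"

text \<open>
  For absolutely continuous \<open>x\<close> the derivative exists almost everywhere; the unspecified
  values of \<^const>\<open>deriv\<close> on the exceptional null set do not affect the integral.
\<close>
definition caputo :: "real \<Rightarrow> (real \<Rightarrow> real) \<Rightarrow> real \<Rightarrow> real" where
  "caputo \<alpha> x = RL_integral (1 - \<alpha>) (deriv x)"

text \<open>
  The space \<open>C\<^sup>\<alpha>\<^sup>,\<^sup>1\<^sub>1\<^sub>-\<^sub>\<alpha>[0,\<infinity>)\<close>. Existence of the Caputo derivative and its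
  differentiability on \<open>(0,\<infinity>)\<close>, implicit on paper, are required explicitly because the
  integral and \<^const>\<open>deriv\<close> are total in Isabelle.
\<close>
definition caputo_space :: "real \<Rightarrow> (real \<Rightarrow> real) set" where
  "caputo_space \<alpha> =
    {x \<in> AC_halfline.
       (\<forall>\<tau>>0. RL_exists (1 - \<alpha>) (deriv x) \<tau>) \<and>
       (\<forall>\<tau>>0. caputo \<alpha> x differentiable at \<tau>) \<and>
       deriv (caputo \<alpha> x) \<in> C_weighted (1 - \<alpha>)}"

definition Phi_class :: "(real \<Rightarrow> real) set" where
  "Phi_class =
    {\<phi>. continuous_on {0<..} \<phi> \<and> mono_on {0<..} \<phi> \<and> (\<forall>w>0. 0 < \<phi> w) \<and>
        (\<forall>w>0. \<forall>v\<ge>1. 1 / v * \<phi> w \<le> \<phi> (w / v))}"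

end

theory Submission
  imports Defs
begin

text \<open>
  Write \<open>g s = f s (x s)\<close>. Inverting the fractional integral turns the initial value problem into
  \<open>x(\<tau>) = b1 + (b2 \<tau>\<^sup>\<alpha> + \<integral>\<^sub>0\<^sup>\<tau> (\<tau> - s)\<^sup>\<alpha> g(s) ds) / \<Gamma>(\<alpha> + 1)\<close>.
  If \<open>g\<close> is absolutely integrable on the half-line, then dividing by \<open>\<tau>\<^sup>\<alpha>\<close> and using dominated
  convergence shows that the quotient tends to \<open>(b2 + \<integral>\<^sub>0\<^sup>\<infinity> g(s) ds) / \<Gamma>(\<alpha> + 1)\<close>
  (\<open>fractional_integral_asymptotics\<close>).

  Integrability of \<open>g\<close> comes from an a priori bound on \<open>y(s) = 1 + |x(s)| / s\<^sup>\<alpha>\<close>. The scaling property of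
  the class \<open>\<Phi>\<close> makes \<open>\<phi>\<close> grow at most linearly and yields \<open>|g(s)| \<le> C s\<^sup>\<alpha> P(s) y(s)\<close> for \<open>s \<ge> 1\<close>
  (\<open>Phi_class_linear_bound\<close>). Inserted in the representation, this is a linear integral inequality for
  \<open>y\<close>, and by \<open>Gronwall\<close> and the integrability of \<open>s\<^sup>\<alpha> P(s)\<close> the function \<open>y\<close> is bounded. The same
  estimate then bounds \<open>|g|\<close> by a multiple of \<open>s\<^sup>\<alpha> P(s)\<close>.

  Most of the work lies in the representation (\<open>caputo_initial_value_representation\<close>), since the Caputo
  derivative is formed with the pointwise derivative of a function that is only absolutely continuous. Exchanging
  the order of integration (\<open>Abel_inversion\<close>) recovers the integral of \<open>x'\<close> from the Caputo derivative.
  To know that this integral is \<open>x(\<tau>) - x(0)\<close>, Lebesgue's theorem is needed: an absolutely continuous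
  function is differentiable almost everywhere (\<open>abs_cont_on_differentiable_ae\<close>) and is the integral of
  its derivative (\<open>fundamental_theorem_of_calculus_abs_cont\<close>). The first part compares two Vitali
  coverings of the set where the slopes oscillate, and the second is a gauge argument.
\<close>

section \<open>Increments over divisions\<close>

text \<open>
  The value $0$ on the empty set makes \<open>incr x\<close> additive over divisions of boxes, empty boxes
  included, so that the library's theory of operative set functions applies to it.
  For \<open>x\<close> the identity it is the length of an interval.
\<close>
definition incr :: "(real \<Rightarrow> real) \<Rightarrow> real set \<Rightarrow> real" where
  "incr x K = (if K = {} then 0 else x (Sup K) - x (Inf K))"

lemma incr_Icc [simp]: "a \<le> b \<Longrightarrow> incr x {a..b} = x b - x a"
  by (simp add: incr_def)

lemma division_of_real_memE:
  fixes D :: "real set set"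
  assumes "D division_of S" "K \<in> D"
  obtains a b where "a \<le> b" "K = {a..b}" "K \<subseteq> S"
  using assms by (metis atLeastatMost_empty_iff2 box_real(2) division_ofD(2,3,4))

lemma sum_incr_division:
  assumes "a \<le> b" "d division_of {a..b}"
  shows "sum (incr x) d = x b - x a"
proof -
  interpret operative_real plus 0 "incr x"
    rewrites "comm_monoid_set.F (+) 0 = sum"
    by standard[1] (auto simp add: sum_def incr_def)
  show ?thesis
    using division[OF assms(2)] assms(1) by simp
qed

text \<open>
  Divisions, unlike indexed families of endpoints, can be extended, restricted and counted by the
  library, so everything below uses absolute continuity in this form.
\<close>
lemma abs_cont_on_division:
  assumes "abs_cont_on S x" "0 < e"
  obtains \<delta> where "0 < \<delta>"
    "\<And>D. D division_of \<Union>D \<Longrightarrow> \<Union>D \<subseteq> S \<Longrightarrow> sum (measure lebesgue) D < \<delta> \<Longrightarrow> (\<Sum>K\<in>D. \<bar>incr x K\<bar>) < e"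
proof -
  from assms(1)[unfolded abs_cont_on_def, THEN spec, THEN mp, OF assms(2)]
  obtain \<delta> where "0 < \<delta>" and \<delta>: "\<forall>(n::nat) a b.
       (\<forall>i<n. a i \<le> b i \<and> {a i..b i} \<subseteq> S) \<and>
       disjoint_family_on (\<lambda>i. {a i<..<b i}) {..<n} \<and>
       (\<Sum>i<n. b i - a i) < \<delta> \<longrightarrow> (\<Sum>i<n. \<bar>x (b i) - x (a i)\<bar>) < e"
    by (elim exE conjE)
  show thesis
  proof (rule that[OF \<open>0 < \<delta>\<close>])
    fix D :: "real set set"
    assume D: "D division_of \<Union>D" "\<Union>D \<subseteq> S" "sum (measure lebesgue) D < \<delta>"
    have "finite D" using D(1) by blast
    then obtain h where h: "bij_betw h {..<card D} D"
      using ex_bij_betw_nat_finite lessThan_atLeast0 by metis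
    have hD: "h i \<in> D" if "i < card D" for i
      using h that by (auto simp: bij_betw_def)
    have "\<exists>a b. a \<le> b \<and> h i = {a..b}" if "i < card D" for i
      using division_of_real_memE[OF D(1) hD[OF that]] by metis
    then obtain a b where ab: "\<And>i. i < card D \<Longrightarrow> a i \<le> b i" "\<And>i. i < card D \<Longrightarrow> h i = {a i..b i}"
      by metis
    have "(\<Sum>i<card D. \<bar>x (b i) - x (a i)\<bar>) < e"
    proof (rule \<delta>[THEN spec, THEN spec, THEN spec, THEN mp], intro conjI)
      show "\<forall>i<card D. a i \<le> b i \<and> {a i..b i} \<subseteq> S"
      proof (intro allI impI conjI)
        fix i assume i: "i < card D"
        show "a i \<le> b i" by (rule ab(1)[OF i])
        show "{a i..b i} \<subseteq> S" using hD[OF i] ab(2)[OF i] D(2) by auto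
      qed
      show "disjoint_family_on (\<lambda>i. {a i<..<b i}) {..<card D}"
        unfolding disjoint_family_on_def
      proof (intro ballI impI)
        fix m n assume mn: "m \<in> {..<card D}" "n \<in> {..<card D}" "m \<noteq> n"
        then have "h m \<noteq> h n"
          using h by (auto simp: bij_betw_def inj_on_def)
        then have "interior (h m) \<inter> interior (h n) = {}"
          using division_ofD(5)[OF D(1)] hD mn by simp
        then show "{a m<..<b m} \<inter> {a n<..<b n} = {}"
          using mn ab(2) by simp
      qed
      have "(\<Sum>i<card D. b i - a i) = (\<Sum>i<card D. measure lebesgue (h i))"
        by (rule sum.cong) (simp_all add: ab)
      also have "\<dots> = sum (measure lebesgue) D"
        by (rule sum.reindex_bij_betw[OF h])
      finally show "(\<Sum>i<card D. b i - a i) < \<delta>"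
        using D(3) by simp
    qed
    also have "(\<Sum>i<card D. \<bar>x (b i) - x (a i)\<bar>) = (\<Sum>i<card D. \<bar>incr x (h i)\<bar>)"
      by (rule sum.cong) (simp_all add: ab)
    also have "\<dots> = (\<Sum>K\<in>D. \<bar>incr x K\<bar>)"
      by (rule sum.reindex_bij_betw[OF h])
    finally show "(\<Sum>K\<in>D. \<bar>incr x K\<bar>) < e" .
  qed
qed

lemma abs_cont_on_uminus: "abs_cont_on S x \<Longrightarrow> abs_cont_on S (\<lambda>t. - x t)"
  by (simp add: abs_cont_on_def abs_minus_commute)

text \<open>
  Removing from the intervals of \<open>F\<close> the smaller intervals of \<open>G\<close> leaves finitely many gaps \<open>D\<close>, and
  increments are additive. With \<open>y\<close> the identity this says that the total length of the gaps is the
  difference of the lengths of \<open>F\<close> and \<open>G\<close>; with \<open>y\<close> an absolutely continuous function, it says that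
  short gaps carry a small part of the increment.
\<close>
lemma incr_nested_divisions:
  fixes F G :: "real set set"
  assumes F: "F division_of \<Union>F" and G: "G division_of \<Union>G"
    and sub: "\<And>K. K \<in> G \<Longrightarrow> \<exists>I\<in>F. K \<subseteq> I"
    and disj: "pairwise disjnt F"
  obtains D where "D division_of \<Union>D" "\<Union>D \<subseteq> \<Union>F" "\<And>y. sum (incr y) F = sum (incr y) G + sum (incr y) D"
proof -
  define H where "H I = {K \<in> G. K \<subseteq> I}" for I
  have finF: "finite F" and finG: "finite G"
    using F G by blast+
  have "\<exists>q. H I \<subseteq> q \<and> q division_of I" if I: "I \<in> F" for I
  proof -
    obtain a b where ab: "I = cbox a b"
      using F I by blast
    have "H I division_of \<Union>(H I)"
      by (rule division_of_subset[OF G]) (auto simp: H_def)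
    moreover have "\<Union>(H I) \<subseteq> cbox a b"
      using ab by (auto simp: H_def)
    ultimately show ?thesis
      using partial_division_extend_interval ab by metis
  qed
  then obtain q where q: "\<And>I. I \<in> F \<Longrightarrow> H I \<subseteq> q I" "\<And>I. I \<in> F \<Longrightarrow> q I division_of I"
    by metis
  define D where "D = (\<Union>I\<in>F. q I - H I)"
  have qI: "K \<subseteq> I" "K \<noteq> {}" if "I \<in> F" "K \<in> q I" for I K
    using q(2)[OF that(1)] that(2) by auto
  have uniq: "I = J" if "I \<in> F" "J \<in> F" "K \<in> q I" "K \<in> q J" for I J K
  proof (rule ccontr)
    assume "I \<noteq> J"
    then have "I \<inter> J = {}"
      using disj that by (auto simp: pairwise_def disjnt_def)
    then show False
      using qI[of I K] qI[of J K] that by blast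
  qed
  have finq: "finite (q I)" if "I \<in> F" for I
    using q(2)[OF that] by blast
  show thesis
  proof (rule that[of D])
    show "\<Union>D \<subseteq> \<Union>F"
      unfolding D_def using qI by blast
    show "D division_of \<Union>D"
    proof (rule division_ofI)
      show "finite D"
        using finF finq by (auto simp: D_def)
      fix K assume "K \<in> D"
      then obtain I where I: "I \<in> F" "K \<in> q I" by (auto simp: D_def)
      show "K \<noteq> {}" using qI I by blast
      show "\<exists>a b. K = cbox a b" using division_ofD(4)[OF q(2)] I by blast
      show "K \<subseteq> \<Union>D" using \<open>K \<in> D\<close> by blast
      fix L assume "L \<in> D" "K \<noteq> L"
      then obtain J where J: "J \<in> F" "L \<in> q J" by (auto simp: D_def)
      show "interior K \<inter> interior L = {}"
      proof (cases "I = J")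
        case True
        then show ?thesis using division_ofD(5)[OF q(2)] I J \<open>K \<noteq> L\<close> by blast
      next
        case False
        then have "I \<inter> J = {}" using disj I J by (auto simp: pairwise_def disjnt_def)
        then show ?thesis using qI I J interior_subset by blast
      qed
    qed simp
    fix y
    have I_eq: "incr y I = sum (incr y) (H I) + sum (incr y) (q I - H I)" if I: "I \<in> F" for I
    proof -
      obtain a b where ab: "a \<le> b" "I = {a..b}"
        using F I by (elim division_of_real_memE) auto
      then have "incr y I = sum (incr y) (q I)"
        using sum_incr_division q(2) I by simp
      then show ?thesis
        using sum.subset_diff[OF q(1) finq, OF I I] by (simp add: add.commute)
    qed
    have G_eq: "G = (\<Union>I\<in>F. H I)"
      using sub by (auto simp: H_def)
    have "sum (incr y) F = (\<Sum>I\<in>F. sum (incr y) (H I)) + (\<Sum>I\<in>F. sum (incr y) (q I - H I))"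
      by (simp add: I_eq sum.distrib)
    also have "(\<Sum>I\<in>F. sum (incr y) (H I)) = sum (incr y) G"
      unfolding G_eq
    proof (rule sum.UNION_disjoint[symmetric])
      show "\<forall>I\<in>F. finite (H I)" using finG by (simp add: H_def)
      show "\<forall>I\<in>F. \<forall>J\<in>F. I \<noteq> J \<longrightarrow> H I \<inter> H J = {}"
        using q(1) uniq by blast
    qed (fact finF)
    also have "(\<Sum>I\<in>F. sum (incr y) (q I - H I)) = sum (incr y) D"
      unfolding D_def
      by (rule sum.UNION_disjoint[symmetric]) (use finF finq uniq in auto)
    finally show "sum (incr y) F = sum (incr y) G + sum (incr y) D" .
  qed
qed

lemma sum_measure_eq_incr:
  assumes "D division_of S"
  shows "sum (measure lebesgue) D = sum (incr (\<lambda>t. t)) D"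
proof (intro sum.cong refl)
  fix K assume "K \<in> D"
  then obtain a b where "a \<le> b" "K = {a..b}"
    using assms by (elim division_of_real_memE)
  then show "measure lebesgue K = incr (\<lambda>t. t) K" by simp
qed

section \<open>Coverings by finitely many intervals\<close>

text \<open>
  The Vitali covering theorem gives countably many disjoint intervals that cover \<open>E\<close> up to a null set.
  They all lie in a set of finite measure, so finitely many of them leave out only a set of
  measure at most \<open>e\<close>. The set \<open>E\<close> is arbitrary: its exceptional part is enclosed in a measurable \<open>N\<close>.
\<close>
lemma Vitali_finite_intervals:
  fixes E U :: "real set"
  assumes U: "open U" "U \<in> lmeasurable" "E \<subseteq> U" and "0 < e"
    and R: "\<And>t d. t \<in> E \<Longrightarrow> 0 < d \<Longrightarrow> \<exists>a b. a < b \<and> b - a < d \<and> t \<in> {a..b} \<and> R {a..b}"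
  obtains F N where "F division_of \<Union>F" "pairwise disjnt F"
    "\<forall>K\<in>F. K \<subseteq> U \<and> R K \<and> (\<exists>a b. a < b \<and> K = {a..b})"
    "E \<subseteq> \<Union>F \<union> N" "N \<in> lmeasurable" "measure lebesgue N \<le> e"
proof -
  note obtained = that
  define \<K> where "\<K> = {(a,b). a < b \<and> {a..b} \<subseteq> U \<and> R {a..b}}"
  (* In one dimension the closed balls of the covering theorem are the intervals, with the midpoint
     as centre and half the length as radius. *)
  define c :: "real \<times> real \<Rightarrow> real" where "c = (\<lambda>(a,b). (a + b) / 2)"
  define r :: "real \<times> real \<Rightarrow> real" where "r = (\<lambda>(a,b). (b - a) / 2)"
  have cball: "cball (c i) (r i) = {fst i..snd i}" for i
    unfolding c_def r_def cball_eq_atLeastAtMost by (cases i) (simp add: field_simps)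
  have cov: "\<exists>i. i \<in> \<K> \<and> t \<in> cball (c i) (r i) \<and> r i < d" if t: "t \<in> E" and d: "0 < d" for t d
  proof -
    obtain \<rho> where \<rho>: "0 < \<rho>" "ball t \<rho> \<subseteq> U"
      using U t open_contains_ball by blast
    obtain a b where ab: "a < b" "b - a < min d \<rho>" "t \<in> {a..b}" "R {a..b}"
      using R[OF t, of "min d \<rho>"] d \<rho> by auto
    have "{a..b} \<subseteq> ball t \<rho>"
      using ab by (auto simp: dist_real_def)
    then have "(a, b) \<in> \<K>"
      using ab \<rho> by (auto simp: \<K>_def)
    moreover have "r (a, b) < d" using ab d by (simp add: r_def)
    ultimately show ?thesis
      using ab cball by (intro exI[of _ "(a,b)"]) auto
  qed
  have rpos: "0 < r i" if "i \<in> \<K>" for i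
    using that by (auto simp: \<K>_def r_def)
  obtain C where C: "countable C" "C \<subseteq> \<K>"
     "pairwise (\<lambda>i j. disjnt (cball (c i) (r i)) (cball (c j) (r j))) C"
     "negligible (E - (\<Union>i \<in> C. cball (c i) (r i)))"
    by (rule Vitali_covering_theorem_cballs[of \<K> r E c, OF rpos cov])
  define J where "J i = {fst i..snd i}" for i :: "real \<times> real"
  note C = C[unfolded cball, folded J_def]
  have JU: "J i \<subseteq> U \<and> R (J i) \<and> (\<exists>a b. a < b \<and> J i = {a..b})" if "i \<in> C" for i
  proof -
    have "i \<in> \<K>" using C(2) that by blast
    then show ?thesis
      unfolding \<K>_def J_def by (cases i) auto
  qed
  have result: thesis if A: "A \<subseteq> C" "finite A"
      and small: "(\<Union>(J ` C) - \<Union>(J ` A)) \<in> lmeasurable" "measure lebesgue (\<Union>(J ` C) - \<Union>(J ` A)) \<le> e" for A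
  proof -
    have disj: "pairwise disjnt (J ` A)"
      unfolding pairwise_def
    proof (intro ballI impI)
      fix K L assume KL: "K \<in> J ` A" "L \<in> J ` A" "K \<noteq> L"
      then obtain i j where "i \<in> A" "j \<in> A" "K = J i" "L = J j" by auto
      with KL show "disjnt K L"
        using pairwiseD[OF C(3), of i j] A(1) by auto
    qed
    have mem: "K \<subseteq> U \<and> R K \<and> (\<exists>a b. a < b \<and> K = {a..b})" if K: "K \<in> J ` A" for K
    proof -
      obtain i where "i \<in> C" "K = J i" using K A(1) by blast
      then show ?thesis using JU[of i] by simp
    qed
    show thesis
    proof (rule obtained[of "J ` A" "(\<Union>(J ` C) - \<Union>(J ` A)) \<union> (E - \<Union>(J ` C))"])
      show "J ` A division_of \<Union> (J ` A)"
      proof (rule division_ofI)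
        fix K assume "K \<in> J ` A"
        then obtain a b where "a < b" "K = {a..b}" using mem[of K] by auto
        then show "K \<noteq> {}" "\<exists>a b. K = cbox a b" by auto
      next
        fix K L assume "K \<in> J ` A" "L \<in> J ` A" "K \<noteq> L"
        then have "K \<inter> L = {}" using disj by (auto simp: pairwise_def disjnt_def)
        then show "interior K \<inter> interior L = {}" using interior_subset by blast
      qed (use A in auto)
      show "pairwise disjnt (J ` A)" by fact
      show "E \<subseteq> \<Union> (J ` A) \<union> (\<Union> (J ` C) - \<Union> (J ` A) \<union> (E - \<Union> (J ` C)))"
        by blast
      have null: "E - \<Union>(J ` C) \<in> null_sets lebesgue"
        using C(4) negligible_iff_null_sets by blast
      show "\<Union> (J ` C) - \<Union> (J ` A) \<union> (E - \<Union> (J ` C)) \<in> lmeasurable"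
        using small(1) C(4) negligible_imp_measurable by blast
      show "measure lebesgue (\<Union> (J ` C) - \<Union> (J ` A) \<union> (E - \<Union> (J ` C))) \<le> e"
        using small null by (simp add: measure_Un_null_set fmeasurableD)
    next
      show "\<forall>K\<in>J ` A. K \<subseteq> U \<and> R K \<and> (\<exists>a b. a < b \<and> K = {a..b})"
        using mem by blast
    qed
  qed
  show thesis
  proof (cases "C = {}")
    case True
    show thesis
      by (rule result[of "{}"]) (use True \<open>0 < e\<close> in auto)
  next
    case False
    define g where "g = from_nat_into C"
    have rg: "range g = C"
      unfolding g_def using False C(1) by (rule range_from_nat_into)
    define B where "B n = \<Union>(J ` C) - \<Union>(J ` g ` {..<n})" for n
    have Jm: "J i \<in> sets lebesgue" for i by (simp add: J_def)
    have BC: "\<Union>(J ` C) \<in> sets lebesgue"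
      by (rule sets.countable_UN') (use C(1) Jm in auto)
    have Bs: "B n \<in> sets lebesgue" for n
      unfolding B_def by (intro sets.Diff BC sets.finite_Union) (use Jm in auto)
    have BU: "B n \<subseteq> U" for n
      unfolding B_def using JU by blast
    have Bl: "B n \<in> lmeasurable" for n
      using fmeasurableI2[OF U(2) BU Bs] .
    have "(\<lambda>n. measure lebesgue (B n)) \<longlonglongrightarrow> measure lebesgue (\<Inter>n. B n)"
    proof (rule Lim_measure_decseq)
      show "range B \<subseteq> sets lebesgue" using Bs by blast
      show "decseq B" unfolding B_def decseq_def by (auto dest: order.strict_trans2)
      show "emeasure lebesgue (B n) \<noteq> \<infinity>" for n
        using fmeasurableD2[OF Bl] by simp
    qed
    moreover have "(\<Inter>n. B n) = {}"
    proof -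
      have "\<exists>n. t \<notin> B n" for t
      proof (cases "t \<in> \<Union>(J ` C)")
        case True
        then obtain k where "t \<in> J (g k)" using rg by blast
        then have "t \<notin> B (Suc k)" by (auto simp: B_def)
        then show ?thesis ..
      qed (auto simp: B_def)
      then show ?thesis by blast
    qed
    ultimately have "(\<lambda>n. measure lebesgue (B n)) \<longlonglongrightarrow> 0" by simp
    then have "\<forall>\<^sub>F n in sequentially. measure lebesgue (B n) < e"
      using order_tendstoD(2) \<open>0 < e\<close> by blast
    then obtain n where "measure lebesgue (B n) < e"
      by (auto simp: eventually_sequentially)
    then have small: "measure lebesgue (\<Union>(J ` C) - \<Union>(J ` g ` {..<n})) \<le> e"
      by (simp add: B_def)
    show thesis
    proof (rule result)
      show "g ` {..<n} \<subseteq> C" using rg by blast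
      show "finite (g ` {..<n})" by simp
      show "\<Union>(J ` C) - \<Union>(J ` g ` {..<n}) \<in> lmeasurable"
        using Bl[of n] by (simp only: B_def)
    qed (rule small)
  qed
qed

section \<open>Differentiability almost everywhere\<close>

text \<open>
  The intervals need only contain \<open>t\<close>, not start or end at it, as in the covering theorem.
  Steepness of \<open>- x\<close> for \<open>- p\<close> says that slopes below \<open>p\<close> occur in arbitrarily short intervals.
\<close>
definition steep_at :: "(real \<Rightarrow> real) \<Rightarrow> real \<Rightarrow> real \<Rightarrow> bool" where
  "steep_at x q t \<longleftrightarrow>
    (\<forall>d>0. \<exists>a b. a < b \<and> b - a < d \<and> t \<in> {a..b} \<and> q * (b - a) < x b - x a)"

lemma steep_at_mono: "steep_at x q t \<Longrightarrow> p \<le> q \<Longrightarrow> steep_at x p t"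
  unfolding steep_at_def by (meson diff_gt_0_iff_gt less_imp_le mult_right_mono order_le_less_trans)

text \<open>
  Locally, in a window \<open>U\<close> shorter than the \<open>\<delta>\<close> that belongs to the total increment $1$, disjoint intervals
  of slope at least \<open>M\<close> have total length at most \<open>1 / M\<close>. They cover the set in question up
  to a set of small measure, and \<open>M\<close> is arbitrary.
\<close>
lemma negligible_infinitely_steep:
  assumes "abs_cont_on {c..d} x"
  shows "negligible {t \<in> {c<..<d}. \<forall>M. steep_at x M t}" (is "negligible ?E")
  unfolding locally_negligible_alt[of ?E]
proof
  obtain \<delta> where "0 < \<delta>" and \<delta>: "\<And>D. D division_of \<Union>D \<Longrightarrow> \<Union>D \<subseteq> {c..d} \<Longrightarrow>
      sum (measure lebesgue) D < \<delta> \<Longrightarrow> (\<Sum>K\<in>D. \<bar>incr x K\<bar>) < 1"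
    using abs_cont_on_division[OF assms zero_less_one] by metis
  fix t assume t: "t \<in> ?E"
  define U where "U = {max c (t - \<delta>/3)<..<min d (t + \<delta>/3)}"
  have Ucd: "U \<subseteq> {c..d}" by (auto simp: U_def)
  have tU: "t \<in> U" using t \<open>0 < \<delta>\<close> by (auto simp: U_def)
  have Um: "U \<in> lmeasurable" by (simp add: U_def)
  have "measure lebesgue U = min d (t + \<delta>/3) - max c (t - \<delta>/3)"
    using tU unfolding U_def by simp
  then have U_small: "measure lebesgue U < \<delta>"
    using \<open>0 < \<delta>\<close> by (simp add: min_def max_def)
  have "negligible (?E \<inter> U)"
    unfolding negligible_outer_le
  proof (intro allI impI)
    fix e :: real assume "0 < e"
    have steep: "\<exists>a b. a < b \<and> b - a < r \<and> s \<in> {a..b} \<and> 2 / e * measure lebesgue {a..b} < incr x {a..b}"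
      if s: "s \<in> ?E \<inter> U" and r: "0 < r" for s r
    proof -
      have "steep_at x (2 / e) s" using s by blast
      then obtain a b where "a < b" "b - a < r" "s \<in> {a..b}" "2 / e * (b - a) < x b - x a"
        using r unfolding steep_at_def by metis
      then show ?thesis by (intro exI[of _ a] exI[of _ b]) auto
    qed
    obtain F N where F: "F division_of \<Union>F" "pairwise disjnt F"
      "\<forall>K\<in>F. K \<subseteq> U \<and> 2 / e * measure lebesgue K < incr x K \<and> (\<exists>a b. a < b \<and> K = {a..b})"
      and N: "?E \<inter> U \<subseteq> \<Union>F \<union> N" "N \<in> lmeasurable" "measure lebesgue N \<le> e / 2"
    proof (rule Vitali_finite_intervals[where R = "\<lambda>K. 2 / e * measure lebesgue K < incr x K"])
      show "open U" by (simp add: U_def)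
      show "0 < e / 2" using \<open>0 < e\<close> by simp
    qed (rule Um inf_le2 steep; assumption)+
    have FU: "\<Union>F \<subseteq> U" using F(3) by blast
    have Fm: "\<Union>F \<in> lmeasurable" using F(1) lmeasurable_division by blast
    have "(\<Sum>K\<in>F. \<bar>incr x K\<bar>) < 1"
    proof (rule \<delta>[OF F(1)])
      show "\<Union>F \<subseteq> {c..d}" using FU Ucd by blast
      show "sum (measure lebesgue) F < \<delta>"
        using content_division[OF F(1)] measure_mono_fmeasurable[OF FU fmeasurableD[OF Fm] Um] U_small by simp
    qed
    have "2 / e * measure lebesgue (\<Union>F) = (\<Sum>K\<in>F. 2 / e * measure lebesgue K)"
      by (simp add: content_division[OF F(1), symmetric] sum_distrib_left)
    also have "\<dots> \<le> (\<Sum>K\<in>F. \<bar>incr x K\<bar>)"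
      by (rule sum_mono) (use F(3) in fastforce)
    also have "\<dots> < 1" by fact
    finally have "measure lebesgue (\<Union>F) \<le> e / 2"
      using \<open>0 < e\<close> by (simp add: field_simps)
    then have "measure lebesgue (\<Union>F \<union> N) \<le> e"
      using measure_Un_le[of "\<Union>F" lebesgue N] Fm N by (simp add: fmeasurableD)
    then show "\<exists>T. ?E \<inter> U \<subseteq> T \<and> T \<in> lmeasurable \<and> measure lebesgue T \<le> e"
      using N Fm by blast
  qed
  moreover have "openin (top_of_set ?E) (?E \<inter> U)"
    by (rule openin_open_Int) (simp add: U_def)
  ultimately show "\<exists>V. openin (top_of_set ?E) V \<and> t \<in> V \<and> negligible V"
    using t tU by blast
qed

text \<open>
  The number \<open>m\<close> is the outer measure of \<open>E\<close>, which need not be measurable.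
\<close>
lemma open_cover_near_outer_measure:
  fixes E :: "real set"
  assumes "\<not> negligible E" "E \<subseteq> {c<..<d}"
  obtains m where "0 < m" "\<And>N. E \<subseteq> N \<Longrightarrow> N \<in> lmeasurable \<Longrightarrow> m \<le> measure lebesgue N"
    "\<And>e. 0 < e \<Longrightarrow> \<exists>U. open U \<and> E \<subseteq> U \<and> U \<subseteq> {c<..<d} \<and> U \<in> lmeasurable \<and> measure lebesgue U < m + e"
proof -
  define A where "A = {measure lebesgue N | N. E \<subseteq> N \<and> N \<in> lmeasurable}"
  have bdd: "bdd_below A" by (rule bdd_belowI[of _ 0]) (auto simp: A_def)
  have ne: "A \<noteq> {}" unfolding A_def using assms(2) by (auto intro!: exI[of _ "{c<..<d}"])
  obtain e where e: "0 < e" "\<And>N. E \<subseteq> N \<Longrightarrow> N \<in> lmeasurable \<Longrightarrow> e < measure lebesgue N"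
    using assms(1) unfolding negligible_outer_le by (meson not_le)
  show thesis
  proof (rule that[of "Inf A"])
    have "e \<le> y" if "y \<in> A" for y
    proof -
      from that obtain N where "E \<subseteq> N" "N \<in> lmeasurable" "y = measure lebesgue N"
        unfolding A_def by blast
      then show ?thesis using e(2)[of N] by simp
    qed
    then have "e \<le> Inf A" by (rule cInf_greatest[OF ne])
    then show "0 < Inf A" using e(1) by simp
    show "Inf A \<le> measure lebesgue N" if "E \<subseteq> N" "N \<in> lmeasurable" for N
      by (rule cInf_lower[OF _ bdd]) (use that in \<open>auto simp: A_def\<close>)
    fix r :: real assume "0 < r"
    then have "Inf A < Inf A + r / 2" by simp
    then obtain N where N: "E \<subseteq> N" "N \<in> lmeasurable" "measure lebesgue N < Inf A + r / 2"
      using cInf_lessD[OF ne] unfolding A_def by blast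
    obtain T where T: "open T" "N \<subseteq> T" "T - N \<in> lmeasurable" "emeasure lebesgue (T - N) < ennreal (r / 2)"
      using sets_lebesgue_outer_open[of N "r / 2"] N(2) \<open>0 < r\<close> by (auto simp: fmeasurableD)
    have TN: "measure lebesgue (T - N) < r / 2"
      using T(3,4) \<open>0 < r\<close> by (simp add: emeasure_eq_measure2 ennreal_less_iff)
    have Tm: "T \<in> lmeasurable"
      using fmeasurable.Un[OF N(2) T(3)] T(2) by (simp add: Un_absorb1 Un_Diff_cancel)
    have "measure lebesgue T \<le> measure lebesgue N + measure lebesgue (T - N)"
      using measure_Un_le[of N lebesgue "T - N"] N(2) T(2,3) by (simp add: fmeasurableD Un_absorb1)
    then have "measure lebesgue T < Inf A + r" using N(3) TN by simp
    moreover have "measure lebesgue (T \<inter> {c<..<d}) \<le> measure lebesgue T"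
      using Tm by (intro measure_mono_fmeasurable) (auto simp: fmeasurableD)
    ultimately show "\<exists>U. open U \<and> E \<subseteq> U \<and> U \<subseteq> {c<..<d} \<and> U \<in> lmeasurable \<and> measure lebesgue U < Inf A + r"
      using T N Tm assms(2) by (intro exI[of _ "T \<inter> {c<..<d}"]) (auto simp: fmeasurable.Int)
  qed
qed

text \<open>
  Suppose that the set has outer measure \<open>m > 0\<close>. Cover most of it by disjoint intervals \<open>F\<close> of slope
  less than \<open>p\<close>, inside an open set of measure barely above \<open>m\<close>. Inside \<open>F\<close>, cover most of it again by
  disjoint intervals \<open>G\<close> of slope greater than \<open>q\<close>. Both families have total length close to \<open>m\<close>, so the
  increment of \<open>x\<close> is at most about \<open>p * m\<close> over \<open>F\<close> and at least about \<open>q * m\<close> over \<open>G\<close>. The gaps between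
  the two families are short, hence by absolute continuity the two increments almost agree, and
  \<open>q * m\<close> is at most about \<open>p * m\<close>, which contradicts \<open>p < q\<close>.
\<close>
lemma negligible_oscillating_slopes:
  assumes x: "abs_cont_on {c..d} x" and "p < q"
  shows "negligible {t \<in> {c<..<d}. steep_at x q t \<and> steep_at (\<lambda>s. - x s) (- p) t}" (is "negligible ?E")
proof (rule ccontr)
  assume "\<not> negligible ?E"
  moreover have "?E \<subseteq> {c<..<d}" by blast
  ultimately obtain m where "0 < m"
    and m: "\<And>N. ?E \<subseteq> N \<Longrightarrow> N \<in> lmeasurable \<Longrightarrow> m \<le> measure lebesgue N"
    and cover: "\<And>e. 0 < e \<Longrightarrow> \<exists>U. open U \<and> ?E \<subseteq> U \<and> U \<subseteq> {c<..<d} \<and> U \<in> lmeasurable \<and> measure lebesgue U < m + e"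
    by (rule open_cover_near_outer_measure) blast
  define \<eta> where "\<eta> = (q - p) * m / 2"
  have "0 < \<eta>" using \<open>p < q\<close> \<open>0 < m\<close> by (simp add: \<eta>_def)
  obtain \<delta> where "0 < \<delta>" and \<delta>: "\<And>D. D division_of \<Union>D \<Longrightarrow> \<Union>D \<subseteq> {c..d} \<Longrightarrow>
      sum (measure lebesgue) D < \<delta> \<Longrightarrow> (\<Sum>K\<in>D. \<bar>incr x K\<bar>) < \<eta>"
    using abs_cont_on_division[OF x \<open>0 < \<eta>\<close>] by metis
  (* The two families differ in length by less than 3 e, which must stay below \<delta>; replacing their
     lengths by m costs 2 e (\<bar>p\<bar> + \<bar>q\<bar>), which must stay below \<eta>. *)
  define e where "e = min (\<delta> / 4) (\<eta> / (2 * (\<bar>p\<bar> + \<bar>q\<bar> + 1)))"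
  have "0 < e" using \<open>0 < \<delta>\<close> \<open>0 < \<eta>\<close> by (simp add: e_def)
  have e1: "3 * e < \<delta>" using \<open>0 < \<delta>\<close> by (simp add: e_def min_def)
  have "e \<le> \<eta> / (2 * (\<bar>p\<bar> + \<bar>q\<bar> + 1))" by (simp add: e_def)
  then have "e * (2 * (\<bar>p\<bar> + \<bar>q\<bar> + 1)) \<le> \<eta>"
    by (simp add: pos_le_divide_eq)
  then have e2: "2 * e * \<bar>p\<bar> + 2 * e * \<bar>q\<bar> < \<eta>"
    using \<open>0 < e\<close> by (simp add: algebra_simps)
  obtain U where U: "open U" "?E \<subseteq> U" "U \<subseteq> {c<..<d}" "U \<in> lmeasurable" "measure lebesgue U < m + e"
    using cover[OF \<open>0 < e\<close>] by blast
  have flat: "\<exists>a b. a < b \<and> b - a < r \<and> s \<in> {a..b} \<and> incr x {a..b} < p * measure lebesgue {a..b}"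
    if s: "s \<in> ?E" and r: "0 < r" for s r
  proof -
    have "steep_at (\<lambda>s. - x s) (- p) s" using s by blast
    then obtain a b where "a < b" "b - a < r" "s \<in> {a..b}" "- p * (b - a) < - x b - - x a"
      using r unfolding steep_at_def by metis
    then show ?thesis by (intro exI[of _ a] exI[of _ b]) auto
  qed
  obtain F N where F: "F division_of \<Union>F" "pairwise disjnt F"
    "\<forall>K\<in>F. K \<subseteq> U \<and> incr x K < p * measure lebesgue K \<and> (\<exists>a b. a < b \<and> K = {a..b})"
    and N: "?E \<subseteq> \<Union>F \<union> N" "N \<in> lmeasurable" "measure lebesgue N \<le> e"
    by (rule Vitali_finite_intervals[OF U(1,4,2) \<open>0 < e\<close> flat])
  (* The second covering has to stay inside single intervals of F, hence inside their interiors.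
     Only the finitely many endpoints are lost. *)
  define V where "V = (\<Union>K\<in>F. interior K)"
  have Fm: "\<Union>F \<in> lmeasurable" using F(1) lmeasurable_division by blast
  have "V \<subseteq> \<Union>F" unfolding V_def using interior_subset by blast
  have "open V" by (auto simp: V_def)
  then have Vm: "V \<in> lmeasurable"
    using fmeasurableI2[OF Fm \<open>V \<subseteq> \<Union>F\<close>] by simp
  have finF: "finite F" using F(1) by blast
  have ends: "negligible (\<Union>F - V)"
  proof -
    have "negligible (\<Union>K\<in>F. K - interior K)"
    proof (rule negligible_Union)
      show "negligible L" if "L \<in> (\<lambda>K. K - interior K) ` F" for L
      proof -
        from that obtain K where "K \<in> F" and L: "L = K - interior K" by blast
        then obtain a b where "a < b" "K = {a..b}" using F(3) by blast
        then have "L \<subseteq> {a, b}" by (auto simp: L)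
        then show ?thesis using negligible_finite finite_subset by blast
      qed
    qed (use finF in simp)
    then show ?thesis
      by (rule negligible_subset) (auto simp: V_def)
  qed
  have steep: "\<exists>a b. a < b \<and> b - a < r \<and> s \<in> {a..b} \<and> q * measure lebesgue {a..b} < incr x {a..b} \<and> (\<exists>I\<in>F. {a..b} \<subseteq> I)"
    if s: "s \<in> ?E \<inter> V" and r: "0 < r" for s r
  proof -
    obtain I where I: "I \<in> F" "s \<in> interior I" using s by (auto simp: V_def)
    then obtain \<rho> where \<rho>: "0 < \<rho>" "ball s \<rho> \<subseteq> I"
      using mem_interior by blast
    have "steep_at x q s" using s by blast
    then obtain a b where ab: "a < b" "b - a < min r \<rho>" "s \<in> {a..b}" "q * (b - a) < x b - x a"
      using r \<rho> unfolding steep_at_def by (metis min_less_iff_conj)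
    have "{a..b} \<subseteq> ball s \<rho>" using ab by (auto simp: dist_real_def)
    then show ?thesis using I \<rho> ab by (intro exI[of _ a] exI[of _ b]) auto
  qed
  obtain G N' where G: "G division_of \<Union>G" "pairwise disjnt G"
    "\<forall>K\<in>G. K \<subseteq> V \<and> (q * measure lebesgue K < incr x K \<and> (\<exists>I\<in>F. K \<subseteq> I)) \<and> (\<exists>a b. a < b \<and> K = {a..b})"
    and N': "?E \<inter> V \<subseteq> \<Union>G \<union> N'" "N' \<in> lmeasurable" "measure lebesgue N' \<le> e"
    by (rule Vitali_finite_intervals[OF \<open>open V\<close> Vm inf_le2 \<open>0 < e\<close>,
        where R = "\<lambda>K. q * measure lebesgue K < incr x K \<and> (\<exists>I\<in>F. K \<subseteq> I)", OF steep])
  obtain D where D: "D division_of \<Union>D" "\<Union>D \<subseteq> \<Union>F" "\<And>y. sum (incr y) F = sum (incr y) G + sum (incr y) D"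
    using incr_nested_divisions[OF F(1) G(1) _ F(2)] G(3) by blast
  have Gm: "\<Union>G \<in> lmeasurable" using G(1) lmeasurable_division by blast
  define LF LG where "LF = measure lebesgue (\<Union>F)" and "LG = measure lebesgue (\<Union>G)"
  have LF: "sum (measure lebesgue) F = LF" and LG: "sum (measure lebesgue) G = LG"
    using content_division[OF F(1)] content_division[OF G(1)] by (simp_all add: LF_def LG_def)
  have FU: "\<Union>F \<subseteq> U" using F(3) by blast
  have FV: "\<Union>G \<subseteq> \<Union>F" using G(3) by blast
  have "LF < m + e"
    using measure_mono_fmeasurable[OF FU fmeasurableD[OF Fm] U(4)] U(5) by (simp add: LF_def)
  moreover have "LG \<le> LF"
    using measure_mono_fmeasurable[OF FV fmeasurableD[OF Gm] Fm] by (simp add: LF_def LG_def)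
  moreover have "m \<le> LG + 2 * e"
  proof -
    have "?E \<subseteq> (\<Union>G \<union> (N \<union> N')) \<union> (\<Union>F - V)" using N(1) N'(1) by blast
    then have "m \<le> measure lebesgue ((\<Union>G \<union> (N \<union> N')) \<union> (\<Union>F - V))"
      using m Gm N N' ends negligible_imp_measurable by blast
    also have "\<dots> = measure lebesgue (\<Union>G \<union> (N \<union> N'))"
      using ends Gm N N' by (intro measure_Un_null_set) (auto simp: negligible_iff_null_sets fmeasurableD)
    also have "\<dots> \<le> LG + measure lebesgue (N \<union> N')"
      unfolding LG_def using Gm N N' by (intro measure_Un_le) (auto simp: fmeasurableD)
    also have "measure lebesgue (N \<union> N') \<le> measure lebesgue N + measure lebesgue N'"
      using N N' by (intro measure_Un_le) (auto simp: fmeasurableD)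
    finally show ?thesis using N N' by simp
  qed
  ultimately have near: "\<bar>LF - m\<bar> \<le> 2 * e" "\<bar>LG - m\<bar> \<le> 2 * e" "LF - LG < 3 * e"
    using \<open>0 < e\<close> by linarith+
  have "sum (measure lebesgue) D = LF - LG"
    using D(3)[of "\<lambda>t. t"] LF LG sum_measure_eq_incr[OF F(1)] sum_measure_eq_incr[OF G(1)]
      sum_measure_eq_incr[OF D(1)] by simp
  moreover have "\<Union>D \<subseteq> {c..d}"
    using D(2) FU U(3) greaterThanLessThan_subseteq_atLeastAtMost_iff[of c d c d] by blast
  ultimately have "(\<Sum>K\<in>D. \<bar>incr x K\<bar>) < \<eta>"
    using \<delta>[OF D(1)] near e1 by simp
  then have gap: "\<bar>sum (incr x) F - sum (incr x) G\<bar> < \<eta>"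
    using D(3)[of x] order_le_less_trans[OF sum_abs[of "incr x" D]] by simp
  have "sum (incr x) F \<le> p * LF"
    unfolding LF[symmetric] sum_distrib_left by (rule sum_mono) (simp add: less_imp_le bspec[OF F(3)])
  moreover have "q * LG \<le> sum (incr x) G"
    unfolding LG[symmetric] sum_distrib_left by (rule sum_mono) (simp add: less_imp_le bspec[OF G(3)])
  ultimately have "q * LG - p * LF < \<eta>" using gap by linarith
  moreover have "p * (LF - m) \<le> 2 * e * \<bar>p\<bar>"
    using mult_mono[OF near(1) order_refl[of "\<bar>p\<bar>"]] \<open>0 < e\<close>
    by (simp add: abs_mult[symmetric] mult.commute)
  moreover have "- q * (LG - m) \<le> 2 * e * \<bar>q\<bar>"
    using mult_mono[OF near(2) order_refl[of "\<bar>q\<bar>"]] \<open>0 < e\<close>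
    by (simp add: abs_mult[symmetric] mult.commute)
  ultimately have "(q - p) * m < \<eta> + \<eta>"
    using e2 by (simp add: algebra_simps)
  then show False by (simp add: \<eta>_def)
qed

text \<open>
  The derivative is the supremum \<open>D\<close> of the numbers \<open>q\<close> such that \<open>x\<close> is steeper than \<open>q\<close> at \<open>t\<close>. In short
  intervals no slope exceeds \<open>D + e\<close>, by definition of \<open>D\<close>, and none is less than \<open>D - e\<close>, because otherwise the
  slopes would oscillate.
\<close>
lemma has_real_derivative_from_slopes:
  assumes P: "\<And>p q. p < q \<Longrightarrow> \<not> (steep_at x q t \<and> steep_at (\<lambda>s. - x s) (- p) t)"
    and up: "\<not> steep_at x M t" and low: "\<not> steep_at (\<lambda>s. - x s) M' t"
  shows "\<exists>D. (x has_real_derivative D) (at t)"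
proof -
  define A where "A = {q. steep_at x q t}"
  define D where "D = Sup A"
  have below: "q \<in> A" if qr: "q < r" and r: "\<not> steep_at (\<lambda>s. - x s) (- r) t" for q r
  proof -
    obtain d where d: "0 < d"
      "\<And>a b. a < b \<Longrightarrow> b - a < d \<Longrightarrow> t \<in> {a..b} \<Longrightarrow> r * (b - a) \<le> x b - x a"
    proof -
      obtain d where d: "0 < d" "\<And>a b. a < b \<Longrightarrow> b - a < d \<Longrightarrow> t \<in> {a..b} \<Longrightarrow> - x b - - x a \<le> - r * (b - a)"
        using r unfolding steep_at_def by (meson not_less)
      show thesis
        by (rule that[OF d(1)]) (use d(2) in fastforce)
    qed
    show ?thesis
      unfolding A_def steep_at_def mem_Collect_eq
    proof (intro allI impI)
      fix h :: real assume "0 < h"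
      (* Any short interval at t will do: all of their slopes are at least r, hence greater than q. *)
      define b where "b = t + min d h / 2"
      have b: "t < b" "b - t < d" "b - t < h"
        using \<open>0 < d\<close> \<open>0 < h\<close> by (auto simp: b_def)
      have "q * (b - t) < r * (b - t)"
        using qr b by (intro mult_strict_right_mono) auto
      also have "\<dots> \<le> x b - x t"
        using d(2)[of t b] b by simp
      finally show "\<exists>a b. a < b \<and> b - a < h \<and> t \<in> {a..b} \<and> q * (b - a) < x b - x a"
        using b by (intro exI[of _ t] exI[of _ b]) auto
    qed
  qed
  have bdd: "bdd_above A"
    using up steep_at_mono unfolding A_def by (intro bdd_aboveI[of _ M]) (metis linear mem_Collect_eq)
  have ne: "A \<noteq> {}"
    using below[of "- M' - 1" "- M'"] low by auto
  have upper: "\<not> steep_at x (D + e) t" if "0 < e" for e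
    using cSup_upper[OF _ bdd] that unfolding A_def D_def by fastforce
  have lower: "\<not> steep_at (\<lambda>s. - x s) (- (D - e)) t" if e: "0 < e" for e
  proof -
    obtain q where "q \<in> A" "D - e < q"
      using less_cSupD[OF ne, of "D - e"] e by (auto simp: D_def)
    then show ?thesis using P[of "D - e" q] by (auto simp: A_def)
  qed
  have "\<exists>d>0. \<forall>y. \<bar>y - t\<bar> < d \<longrightarrow> \<bar>x y - x t - (y - t) * D\<bar> \<le> e * \<bar>y - t\<bar>" if e: "0 < e" for e
  proof -
    obtain d1 where d1: "0 < d1"
      "\<And>a b. a < b \<Longrightarrow> b - a < d1 \<Longrightarrow> t \<in> {a..b} \<Longrightarrow> x b - x a \<le> (D + e) * (b - a)"
      using upper[OF e] unfolding steep_at_def by (meson not_less)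
    obtain d2 where d2: "0 < d2"
      "\<And>a b. a < b \<Longrightarrow> b - a < d2 \<Longrightarrow> t \<in> {a..b} \<Longrightarrow> - x b - - x a \<le> - (D - e) * (b - a)"
      using lower[OF e] unfolding steep_at_def by (meson not_less)
    show ?thesis
    proof (intro exI[of _ "min d1 d2"] conjI allI impI)
      fix y assume y: "\<bar>y - t\<bar> < min d1 d2"
      consider "y = t" | "t < y" | "y < t" by linarith
      then show "\<bar>x y - x t - (y - t) * D\<bar> \<le> e * \<bar>y - t\<bar>"
      proof cases
        case 2
        then show ?thesis
          using d1(2)[of t y] d2(2)[of t y] y by (simp add: algebra_simps abs_le_iff)
      next
        case 3
        then show ?thesis
          using d1(2)[of y t] d2(2)[of y t] y by (simp add: algebra_simps abs_le_iff)
      qed simp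
    qed (use d1 d2 in simp)
  qed
  then have "(x has_derivative (\<lambda>h. h * D)) (at t)"
    unfolding has_derivative_at_alt by (simp add: bounded_linear_mult_left)
  then have "(x has_real_derivative D) (at t)"
    unfolding has_field_derivative_def by (rule has_derivative_eq_rhs) (simp add: fun_eq_iff)
  then show ?thesis ..
qed

text \<open>
  Rational bounds \<open>p < q\<close> suffice to detect oscillation, so the exceptional points lie in a countable
  union of null sets.
\<close>
theorem abs_cont_on_differentiable_ae:
  assumes x: "abs_cont_on {c..d} x"
  shows "negligible {t \<in> {c<..<d}. \<not> x differentiable (at t)}"
proof -
  define Z where "Z = (\<lambda>(p, q). {t \<in> {c<..<d}. steep_at x q t \<and> steep_at (\<lambda>s. - x s) (- p) t})"
  define B where "B = \<Union>(Z ` {(p, q) \<in> \<rat> \<times> \<rat>. p < q})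
     \<union> {t \<in> {c<..<d}. \<forall>M. steep_at x M t} \<union> {t \<in> {c<..<d}. \<forall>M. steep_at (\<lambda>s. - x s) M t}"
  have "countable {(p, q) \<in> \<rat> \<times> \<rat>. p < (q::real)}"
    by (rule countable_subset[of _ "\<rat> \<times> \<rat>"]) (auto simp: countable_rat)
  then have "negligible (\<Union>(Z ` {(p, q) \<in> \<rat> \<times> \<rat>. p < q}))"
    using negligible_oscillating_slopes[OF x] by (intro negligible_countable_Union) (auto simp: Z_def)
  then have "negligible B"
    unfolding B_def
    using negligible_infinitely_steep[OF x] negligible_infinitely_steep[OF abs_cont_on_uminus[OF x]]
    by (intro negligible_Un) auto
  then show ?thesis
  proof (rule negligible_subset, safe)
    fix t assume t: "t \<in> {c<..<d}" "\<not> x differentiable (at t)"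
    show "t \<in> B"
    proof (rule ccontr)
      assume tB: "t \<notin> B"
      obtain M M' where M: "\<not> steep_at x M t" "\<not> steep_at (\<lambda>s. - x s) M' t"
        using tB t unfolding B_def by blast
      have "\<not> (steep_at x q t \<and> steep_at (\<lambda>s. - x s) (- p) t)" if pq: "p < q" for p q
      proof
        assume steep: "steep_at x q t \<and> steep_at (\<lambda>s. - x s) (- p) t"
        obtain p' where p': "p' \<in> \<rat>" "p < p'" "p' < q" using Rats_dense_in_real[OF pq] by blast
        obtain q' where q': "q' \<in> \<rat>" "p' < q'" "q' < q" using Rats_dense_in_real[OF p'(3)] by blast
        have "steep_at x q' t" "steep_at (\<lambda>s. - x s) (- p') t"
          using steep p' q' by (auto intro: steep_at_mono)
        then have "t \<in> Z (p', q')" using t by (simp add: Z_def)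
        then show False using tB p' q' unfolding B_def by blast
      qed
      then have "\<exists>D. (x has_real_derivative D) (at t)"
        using M by (rule has_real_derivative_from_slopes)
      then show False using t(2) real_differentiable_def by blast
    qed
  qed
qed

section \<open>The fundamental theorem of calculus\<close>

text \<open>
  This is proved directly for the gauge integral, so integrability of \<open>v\<close> is a conclusion.
  At a point where \<open>x\<close> is differentiable the gauge makes the increment of \<open>x\<close> close to its linear
  approximation. At a point of \<open>E\<close> it keeps the tagged interval inside an open set \<open>T\<close> of small measure; the total
  increment of \<open>x\<close> over these intervals is then small by absolute continuity.
\<close>
theorem fundamental_theorem_of_calculus_abs_cont:
  assumes x: "abs_cont_on {a..b} x" and "a \<le> b" and E: "negligible E"
    and deriv: "\<And>t. t \<in> {a..b} - E \<Longrightarrow> (x has_vector_derivative v t) (at t within {a..b})"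
  shows "(v has_integral x b - x a) {a..b}"
proof (rule has_integral_spike[OF E])
  (* With value 0 on E, the integrand contributes nothing to the Riemann sums there. *)
  define w where "w t = (if t \<in> E then 0 else v t)" for t
  show "\<And>t. t \<in> {a..b} - E \<Longrightarrow> v t = w t" by (simp add: w_def)
  show "(w has_integral x b - x a) {a..b}"
    unfolding has_integral_real
  proof (intro allI impI)
    fix e :: real assume "0 < e"
    obtain \<delta> where "0 < \<delta>" and \<delta>: "\<And>D. D division_of \<Union>D \<Longrightarrow> \<Union>D \<subseteq> {a..b} \<Longrightarrow>
        sum (measure lebesgue) D < \<delta> \<Longrightarrow> (\<Sum>K\<in>D. \<bar>incr x K\<bar>) < e / 2"
      using abs_cont_on_division[OF x, of "e/2"] \<open>0 < e\<close> by (metis half_gt_zero)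
    have "E \<in> sets lebesgue" using E negligible_imp_sets by blast
    then obtain T where T: "open T" "E \<subseteq> T" "T - E \<in> lmeasurable" "emeasure lebesgue (T - E) < ennreal \<delta>"
      using sets_lebesgue_outer_open[OF _ \<open>0 < \<delta>\<close>] by blast
    have Tm: "T \<in> lmeasurable"
      using fmeasurable.Un[OF T(3) negligible_imp_measurable[OF E]] T(2) by (simp add: Un_absorb2)
    have "measure lebesgue T = measure lebesgue (T - E)"
      using E Tm by (simp add: measure_Diff_null_set negligible_iff_null_sets fmeasurableD)
    then have T_small: "measure lebesgue T < \<delta>"
      using T(3,4) \<open>0 < \<delta>\<close> by (simp add: emeasure_eq_measure2 ennreal_less_iff)
    define \<kappa> where "\<kappa> = e / (2 * (b - a + 1))"
    have "0 < \<kappa>" using \<open>0 < e\<close> \<open>a \<le> b\<close> by (simp add: \<kappa>_def)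
    have "\<exists>d>0. \<forall>y\<in>{a..b}. \<bar>y - t\<bar> < d \<longrightarrow> \<bar>x y - x t - (y - t) * v t\<bar> \<le> \<kappa> * \<bar>y - t\<bar>"
      if "t \<in> {a..b} - E" for t
      using deriv[OF that] \<open>0 < \<kappa>\<close>
      unfolding has_vector_derivative_def has_derivative_within_alt by simp
    then obtain d where d: "\<And>t. t \<in> {a..b} - E \<Longrightarrow> 0 < d t"
      "\<And>t y. t \<in> {a..b} - E \<Longrightarrow> y \<in> {a..b} \<Longrightarrow> \<bar>y - t\<bar> < d t \<Longrightarrow> \<bar>x y - x t - (y - t) * v t\<bar> \<le> \<kappa> * \<bar>y - t\<bar>"
      by metis
    define \<gamma> where "\<gamma> t = (if t \<in> E then T else if t \<in> {a..b} then ball t (d t) else UNIV)" for t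
    have gauge: "gauge \<gamma>"
      using T d(1) by (auto simp: gauge_def \<gamma>_def)
    have close: "norm ((\<Sum>(t, K)\<in>p. measure lborel K *\<^sub>R w t) - (x b - x a)) < e"
      if p: "p tagged_division_of {a..b}" and fine: "\<gamma> fine p" for p
    proof -
      have finp: "finite p" using p by blast
      define r where "r = {(t, K) \<in> p. t \<in> E}"
      have rp: "r \<subseteq> p" by (auto simp: r_def)
      have boxp: "\<exists>u v. u \<le> v \<and> K = {u..v} \<and> t \<in> {u..v} \<and> {u..v} \<subseteq> {a..b}" if "(t, K) \<in> p" for t K
        using tagged_division_ofD(2-4)[OF p that] by fastforce
      have good: "\<bar>measure lborel K *\<^sub>R w t - incr x K\<bar> \<le> \<kappa> * measure lborel K" if "(t, K) \<in> p - r" for t K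
      proof -
        have tK: "(t, K) \<in> p" "t \<notin> E" using that by (auto simp: r_def)
        obtain u v' where K: "u \<le> v'" "K = {u..v'}" "t \<in> {u..v'}" "{u..v'} \<subseteq> {a..b}"
          using boxp[OF tK(1)] by blast
        have t: "t \<in> {a..b} - E" using K tK by blast
        have "K \<subseteq> ball t (d t)"
          using fineD[OF fine tK(1)] t by (simp add: \<gamma>_def split: if_splits)
        then have "\<bar>u - t\<bar> < d t" "\<bar>v' - t\<bar> < d t"
          using K subsetD[of K "ball t (d t)" u] subsetD[of K "ball t (d t)" v']
          by (auto simp: dist_real_def abs_minus_commute)
        moreover have "u \<in> {a..b}" "v' \<in> {a..b}" using K by auto
        ultimately have "\<bar>x v' - x t - (v' - t) * v t\<bar> \<le> \<kappa> * \<bar>v' - t\<bar>"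
            "\<bar>x u - x t - (u - t) * v t\<bar> \<le> \<kappa> * \<bar>u - t\<bar>"
          using d(2)[OF t] by blast+
        then have "\<bar>(v' - u) * v t - (x v' - x u)\<bar> \<le> \<kappa> * (v' - u)"
          using K(3) unfolding abs_le_iff by (simp add: algebra_simps)
        then show ?thesis using K tK by (simp add: w_def)
      qed
      have bad: "(\<Sum>(t, K)\<in>r. \<bar>incr x K\<bar>) < e / 2"
      proof -
        have r: "r tagged_partial_division_of {a..b}"
          using tagged_partial_division_subset[OF _ rp] p tagged_division_of_def by blast
        have "(\<Sum>(t, K)\<in>r. \<bar>incr x K\<bar>) = (\<Sum>K\<in>snd ` r. \<bar>incr x K\<bar>)"
        proof (rule sum.over_tagged_division_lemma[OF tagged_partial_division_of_Union_self[OF r]])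
          show "\<bar>incr x (cbox u v)\<bar> = 0" if "box u v = {}" for u v
            using that by (cases "u = v") (auto simp: incr_def)
        qed
        also have "\<dots> < e / 2"
        proof (rule \<delta>)
          show div: "snd ` r division_of \<Union>(snd ` r)"
            by (rule partial_division_of_tagged_division[OF r])
          show "\<Union>(snd ` r) \<subseteq> {a..b}"
            using rp boxp by fastforce
          have sub: "\<Union>(snd ` r) \<subseteq> T"
            using fineD[OF fine] rp by (fastforce simp: r_def \<gamma>_def)
          have "sum (measure lebesgue) (snd ` r) = measure lebesgue (\<Union>(snd ` r))"
            by (rule content_division[OF div])
          also have "\<dots> \<le> measure lebesgue T"
            using lmeasurable_division[OF div] by (intro measure_mono_fmeasurable[OF sub _ Tm]) (simp add: fmeasurableD)
          finally show "sum (measure lebesgue) (snd ` r) < \<delta>" using T_small by simp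
        qed
        finally show ?thesis .
      qed
      have "(\<Sum>(t, K)\<in>p. measure lborel K *\<^sub>R w t) - (x b - x a) = (\<Sum>(t, K)\<in>p. measure lborel K *\<^sub>R w t - incr x K)"
      proof -
        have "(\<Sum>(t, K)\<in>p. incr x K) = (\<Sum>(t, K)\<in>p. x (Sup K) - x (Inf K))"
          using boxp by (intro sum.cong) (fastforce simp: incr_def)+
        then show ?thesis
          using additive_tagged_division_1[OF \<open>a \<le> b\<close> p, of x]
          by (simp add: sum_subtractf case_prod_unfold)
      qed
      also have "\<dots> = (\<Sum>(t, K)\<in>p - r. measure lborel K *\<^sub>R w t - incr x K) + (\<Sum>(t, K)\<in>r. measure lborel K *\<^sub>R w t - incr x K)"
        by (rule sum.subset_diff[OF rp finp])
      also have "(\<Sum>(t, K)\<in>r. measure lborel K *\<^sub>R w t - incr x K) = (\<Sum>(t, K)\<in>r. - incr x K)"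
        by (rule sum.cong) (auto simp: r_def w_def)
      finally have "\<bar>(\<Sum>(t, K)\<in>p. measure lborel K *\<^sub>R w t) - (x b - x a)\<bar>
          \<le> \<bar>\<Sum>(t, K)\<in>p - r. measure lborel K *\<^sub>R w t - incr x K\<bar> + \<bar>\<Sum>(t, K)\<in>r. - incr x K\<bar>"
        by simp
      also have "\<bar>\<Sum>(t, K)\<in>p - r. measure lborel K *\<^sub>R w t - incr x K\<bar> \<le> (\<Sum>(t, K)\<in>p - r. \<kappa> * measure lborel K)"
        using good by (intro order_trans[OF sum_abs] sum_mono) auto
      also have "\<dots> \<le> (\<Sum>(t, K)\<in>p. \<kappa> * measure lborel K)"
        using \<open>0 < \<kappa>\<close> finp by (intro sum_mono2) auto
      also have "\<dots> = \<kappa> * (b - a)"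
        using additive_content_tagged_division[of p a b] p \<open>a \<le> b\<close>
        by (simp add: sum_distrib_left[symmetric] case_prod_unfold)
      also have "\<dots> < e / 2"
        using \<open>0 < e\<close> \<open>a \<le> b\<close> by (simp add: \<kappa>_def field_simps)
      also have "\<bar>\<Sum>(t, K)\<in>r. - incr x K\<bar> \<le> (\<Sum>(t, K)\<in>r. \<bar>incr x K\<bar>)"
        by (rule order_trans[OF sum_abs]) (simp add: case_prod_unfold)
      also note bad
      finally show ?thesis by simp
    qed
    show "\<exists>\<gamma>. gauge \<gamma> \<and> (\<forall>p. p tagged_division_of {a..b} \<and> \<gamma> fine p \<longrightarrow>
        norm ((\<Sum>(t, K)\<in>p. measure lborel K *\<^sub>R w t) - (x b - x a)) < e)"
    proof (intro exI[of _ \<gamma>] conjI allI impI)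
      fix p assume "p tagged_division_of {a..b} \<and> \<gamma> fine p"
      then show "norm ((\<Sum>(t, K)\<in>p. measure lborel K *\<^sub>R w t) - (x b - x a)) < e"
        by (intro close) simp_all
    qed (rule gauge)
  qed
qed

section \<open>Inversion of fractional integration\<close>

text \<open>
  The Beta integral, transported from \<open>{0..1}\<close> to \<open>{s..\<tau>}\<close>.
\<close>
lemma has_integral_Beta_Icc:
  fixes a b s \<tau> :: real
  assumes "0 < a" "0 < b" "s < \<tau>"
  shows "((\<lambda>r. (r - s) powr (a - 1) * (\<tau> - r) powr (b - 1)) has_integral (\<tau> - s) powr (a + b - 1) * Beta a b) {s..\<tau>}"
proof -
  define l where "l = \<tau> - s"
  have "0 < l" using assms by (simp add: l_def)
  have "((\<lambda>t. t powr (a - 1) * (1 - t) powr (b - 1)) has_integral Beta a b) (cbox 0 1)"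
    using has_integral_Beta_real[OF assms(1,2)] by simp
  moreover have "(0 - - s / l) /\<^sub>R (1 / l) = s" "(1 - - s / l) /\<^sub>R (1 / l) = \<tau>"
    using \<open>0 < l\<close> by (auto simp: l_def field_simps)
  ultimately
  have "((\<lambda>r. (r / l - s / l) powr (a - 1) * (1 - (r / l - s / l)) powr (b - 1)) has_integral l * Beta a b) {s..\<tau>}"
    using has_integral_affinity'[of "\<lambda>t. t powr (a - 1) * (1 - t) powr (b - 1)" "Beta a b" 0 1 "1 / l" "- s / l"] \<open>0 < l\<close>
    by simp
  then have "((\<lambda>r. l powr (a + b - 2) * ((r / l - s / l) powr (a - 1) * (1 - (r / l - s / l)) powr (b - 1)))
      has_integral l powr (a + b - 2) * (l * Beta a b)) {s..\<tau>}"
    by (rule has_integral_mult_right)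
  moreover have "l powr (a + b - 2) * ((r / l - s / l) powr (a - 1) * (1 - (r / l - s / l)) powr (b - 1))
      = (r - s) powr (a - 1) * (\<tau> - r) powr (b - 1)" if "r \<in> {s..\<tau>}" for r
  proof -
    have "\<tau> = s + l" by (simp add: l_def)
    then have "r / l - s / l = (r - s) / l" "1 - (r / l - s / l) = (\<tau> - r) / l"
      using \<open>0 < l\<close> by (simp_all add: field_simps)
    moreover have "l powr (a + b - 2) = l powr (a - 1) * l powr (b - 1)"
      by (simp add: powr_add[symmetric])
    ultimately show ?thesis
      using that \<open>0 < l\<close> by (simp add: powr_divide)
  qed
  moreover have "l powr (a + b - 2) * (l * Beta a b) = (\<tau> - s) powr (a + b - 1) * Beta a b"
  proof -
    have "l powr (a + b - 1) = l powr (a + b - 2) * l powr 1"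
      unfolding powr_add[symmetric] by (simp add: algebra_simps)
    then show ?thesis using \<open>0 < l\<close> by (simp add: l_def)
  qed
  ultimately show ?thesis
    by (smt (verit, best) has_integral_eq)
qed

text \<open>
  The exponents add up to \<open>- 1\<close>, so that the value is independent of the endpoints. This is why
  fractional integration of orders \<open>\<alpha>\<close> and \<open>1 - \<alpha>\<close> compose to ordinary integration.
\<close>
lemma Abel_kernel:
  fixes \<alpha> s \<tau> :: real
  assumes "0 < \<alpha>" "\<alpha> < 1" "s < \<tau>"
  shows "integrable lborel (\<lambda>r. indicator {s..\<tau>} r * ((r - s) powr - \<alpha> * (\<tau> - r) powr (\<alpha> - 1)))" (is ?int)
    and "(LINT r|lborel. indicator {s..\<tau>} r * ((r - s) powr - \<alpha> * (\<tau> - r) powr (\<alpha> - 1))) = Gamma \<alpha> * Gamma (1 - \<alpha>)"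
proof -
  let ?k = "\<lambda>r. (r - s) powr - \<alpha> * (\<tau> - r) powr (\<alpha> - 1)"
  have I: "(?k has_integral Gamma \<alpha> * Gamma (1 - \<alpha>)) {s..\<tau>}"
    using has_integral_Beta_Icc[of "1 - \<alpha>" \<alpha> s \<tau>] assms
    by (simp add: Beta_def rGamma_inverse_Gamma mult.commute)
  have "?k absolutely_integrable_on {s..\<tau>}"
    using I by (intro nonnegative_absolutely_integrable_1) auto
  then have leb: "integrable lebesgue (\<lambda>r. indicator {s..\<tau>} r * ?k r)"
    by (simp add: set_integrable_def)
  then show int: ?int
    by (subst integrable_completion[symmetric]) auto
  have "((\<lambda>r. indicator {s..\<tau>} r * ?k r) has_integral (LINT r|lborel. indicator {s..\<tau>} r * ?k r)) UNIV"
    by (rule has_integral_integral_lborel[OF int])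
  moreover have "(\<lambda>r. indicator {s..\<tau>} r * ?k r) = (\<lambda>r. if r \<in> {s..\<tau>} then ?k r else 0)"
    by (auto simp: indicator_def)
  ultimately have "(?k has_integral (LINT r|lborel. indicator {s..\<tau>} r * ?k r)) {s..\<tau>}"
    by (simp only: has_integral_restrict_UNIV)
  then show "(LINT r|lborel. indicator {s..\<tau>} r * ?k r) = Gamma \<alpha> * Gamma (1 - \<alpha>)"
    using I has_integral_unique by blast
qed

text \<open>
  Exchange the order of integration in the double integral of
  \<open>(\<tau> - r) powr (\<alpha> - 1) * (r - s) powr - \<alpha> * v s\<close> over \<open>0 \<le> s \<le> r \<le> \<tau>\<close>: the inner integral over \<open>r\<close> is the
  constant of the previous lemma.
\<close>
theorem Abel_inversion:
  fixes \<alpha> \<tau> :: real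
  assumes \<alpha>: "0 < \<alpha>" "\<alpha> < 1" and "0 < \<tau>" and v: "set_integrable lebesgue {0..\<tau>} v"
  shows "((\<lambda>r. (\<tau> - r) powr (\<alpha> - 1) * RL_integral (1 - \<alpha>) v r)
           has_integral Gamma \<alpha> * (LINT s:{0..\<tau>}|lebesgue. v s)) {0..\<tau>}"
proof -
  have Gamma_pos: "0 < Gamma (1 - \<alpha>)"
    using \<alpha> by (simp add: Gamma_real_pos)
  define v0 where "v0 s = indicator {0..\<tau>} s * v s" for s
  have v0: "integrable lebesgue v0"
    using v by (simp add: v0_def[abs_def] set_integrable_def)
  then have v0m [measurable]: "v0 \<in> borel_measurable lebesgue" by simp
  (* Joint measurability on the product is immediate for Borel functions, so the Lebesgue measurable
     function v is replaced by a Borel function that agrees with it almost everywhere. *)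
  obtain w where w [measurable]: "w \<in> borel_measurable lborel" and ae: "AE s in lborel. v0 s = w s"
    using completion_ex_borel_measurable_real[OF v0m] by blast
  have ael: "AE s in lebesgue. v0 s = w s"
    using ae by (rule AE_completion)
  have "integrable lebesgue w"
    using integrable_cong_AE[OF _ _ ael] v0 w measurable_completion by blast
  then have wint: "integrable lborel w"
    using integrable_completion[OF w] by simp
  define k where "k s r = indicator {0..\<tau>} s * indicator {s..\<tau>} r * ((r - s) powr - \<alpha> * (\<tau> - r) powr (\<alpha> - 1))"
    for s r :: real
  have k_eq: "k s = (\<lambda>r. indicator {0..\<tau>} s * (indicator {s..\<tau>} r * ((r - s) powr - \<alpha> * (\<tau> - r) powr (\<alpha> - 1))))" for s
    by (simp add: k_def fun_eq_iff)
  have k_nonneg: "0 \<le> k s r" for s r by (simp add: k_def)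
  define f where "f s r = w s * k s r" for s r
  have fm: "case_prod f \<in> borel_measurable (lborel \<Otimes>\<^sub>M lborel)"
  proof -
    have "f s r = w s * (if 0 \<le> s \<and> s \<le> r \<and> r \<le> \<tau> then (r - s) powr - \<alpha> * (\<tau> - r) powr (\<alpha> - 1) else 0)" for s r
      by (auto simp: f_def k_def indicator_def)
    then show ?thesis by (simp add: case_prod_unfold)
  qed
  (* For s = \<tau> the interval of integration degenerates to a point and the integral vanishes instead;
     a single point is a null set. *)
  have kint: "integrable lborel (k s)" "(LINT r|lborel. k s r) = indicator {0..\<tau>} s * (Gamma \<alpha> * Gamma (1 - \<alpha>))" if "s \<noteq> \<tau>" for s
  proof -
    have "integrable lborel (k s) \<and> (LINT r|lborel. k s r) = indicator {0..\<tau>} s * (Gamma \<alpha> * Gamma (1 - \<alpha>))"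
    proof (cases "s < \<tau>")
      case True
      then show ?thesis
        unfolding k_eq using Abel_kernel[OF \<alpha> True] by simp
    next
      case False
      then have "s \<notin> {0..\<tau>}" using that by simp
      then show ?thesis by (simp add: k_eq)
    qed
    then show "integrable lborel (k s)" "(LINT r|lborel. k s r) = indicator {0..\<tau>} s * (Gamma \<alpha> * Gamma (1 - \<alpha>))"
      by auto
  qed
  have ne: "AE s in lborel. s \<noteq> \<tau>" by (rule AE_lborel_singleton)
  have inner: "AE s in lborel. (LINT r|lborel. f s r) = Gamma \<alpha> * Gamma (1 - \<alpha>) * (indicator {0..\<tau>} s * w s)"
    using ne by eventually_elim (simp add: f_def kint)
  have inner_abs: "AE s in lborel. (LINT r|lborel. norm (f s r)) = Gamma \<alpha> * Gamma (1 - \<alpha>) * (indicator {0..\<tau>} s * \<bar>w s\<bar>)"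
    using ne by eventually_elim (simp add: f_def abs_mult k_nonneg kint)
  have f_int: "integrable (lborel \<Otimes>\<^sub>M lborel) (case_prod f)"
  proof (rule lborel_pair.Fubini_integrable[OF fm])
    have "integrable lborel (\<lambda>s. Gamma \<alpha> * Gamma (1 - \<alpha>) * (indicator {0..\<tau>} s * \<bar>w s\<bar>))"
      using integrable_real_mult_indicator[of "{0..\<tau>}" lborel "\<lambda>s. \<bar>w s\<bar>"] wint
      by (intro integrable_mult_right) (simp add: mult.commute)
    moreover have "(\<lambda>s. LINT r|lborel. norm (case_prod f (s, r))) \<in> borel_measurable lborel"
      using fm by (intro lborel.borel_measurable_lebesgue_integral) simp
    ultimately show "integrable lborel (\<lambda>s. LINT r|lborel. norm (case_prod f (s, r)))"
      using inner_abs by (subst integrable_cong_AE) (auto simp: wint)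
    show "AE s in lborel. integrable lborel (\<lambda>r. case_prod f (s, r))"
      using ne by eventually_elim (simp add: f_def kint)
  qed
  have outer: "(LINT s|lborel. f s r) = indicator {0..\<tau>} r * (Gamma (1 - \<alpha>) * ((\<tau> - r) powr (\<alpha> - 1) * RL_integral (1 - \<alpha>) v r))" for r
  proof (cases "r \<in> {0..\<tau>}")
    case False
    then have "f s r = 0" for s by (auto simp: f_def k_def indicator_def)
    then show ?thesis using False by simp
  next
    case True
    have "(LINT s:{0..r}|lebesgue. (r - s) powr - \<alpha> * v s) = (LINT s|lebesgue. indicator {0..r} s * (r - s) powr - \<alpha> * v0 s)"
      unfolding set_lebesgue_integral_def using True
      by (intro Bochner_Integration.integral_cong) (auto simp: v0_def indicator_def)
    also have "\<dots> = (LINT s|lebesgue. indicator {0..r} s * (r - s) powr - \<alpha> * w s)"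
    proof (rule integral_cong_AE)
      have m: "(\<lambda>s. indicator {0..r} s * (r - s) powr - \<alpha>) \<in> borel_measurable lebesgue"
        by (rule measurable_completion) simp
      show "(\<lambda>s. indicator {0..r} s * (r - s) powr - \<alpha> * v0 s) \<in> borel_measurable lebesgue"
        using m v0m by (rule borel_measurable_times)
      show "(\<lambda>s. indicator {0..r} s * (r - s) powr - \<alpha> * w s) \<in> borel_measurable lebesgue"
        using m measurable_completion[OF w] by (rule borel_measurable_times)
      show "AE s in lebesgue. indicator {0..r} s * (r - s) powr - \<alpha> * v0 s = indicator {0..r} s * (r - s) powr - \<alpha> * w s"
        using ael by eventually_elim simp
    qed
    also have "\<dots> = (LINT s|lborel. indicator {0..r} s * (r - s) powr - \<alpha> * w s)"
      by (rule integral_completion) simp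
    finally have "Gamma (1 - \<alpha>) * RL_integral (1 - \<alpha>) v r = (LINT s|lborel. indicator {0..r} s * (r - s) powr - \<alpha> * w s)"
      using Gamma_pos by (simp add: RL_integral_def)
    moreover have "f s r = (\<tau> - r) powr (\<alpha> - 1) * (indicator {0..r} s * (r - s) powr - \<alpha> * w s)" for s
      using True by (auto simp: f_def k_def indicator_def)
    ultimately show ?thesis using True by simp
  qed
  have swap: "(LINT r|lborel. LINT s|lborel. f s r) = (LINT s|lborel. LINT r|lborel. f s r)"
    by (rule lborel_pair.Fubini_integral[OF f_int])
  also have "\<dots> = (LINT s|lborel. Gamma \<alpha> * Gamma (1 - \<alpha>) * (indicator {0..\<tau>} s * w s))"
    using inner fm by (intro integral_cong_AE lborel.borel_measurable_lebesgue_integral) auto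
  also have "\<dots> = Gamma \<alpha> * Gamma (1 - \<alpha>) * (LINT s|lborel. indicator {0..\<tau>} s * w s)"
    by simp
  also have "(LINT s|lborel. indicator {0..\<tau>} s * w s) = (LINT s|lebesgue. indicator {0..\<tau>} s * w s)"
    by (rule integral_completion[symmetric]) simp
  also have "\<dots> = (LINT s:{0..\<tau>}|lebesgue. v s)"
    unfolding set_lebesgue_integral_def
  proof (rule integral_cong_AE)
    have m: "indicator {0..\<tau>} \<in> borel_measurable lebesgue"
      by (rule measurable_completion) simp
    show "(\<lambda>s. indicator {0..\<tau>} s * w s) \<in> borel_measurable lebesgue"
      using m measurable_completion[OF w] by (rule borel_measurable_times)
    show "(\<lambda>s. indicator {0..\<tau>} s *\<^sub>R v s) \<in> borel_measurable lebesgue"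
      using v0m by (simp add: v0_def[abs_def])
    show "AE s in lebesgue. indicator {0..\<tau>} s * w s = indicator {0..\<tau>} s *\<^sub>R v s"
      using ael
    proof eventually_elim
      case (elim s)
      then show ?case by (simp add: elim[symmetric] v0_def indicator_def)
    qed
  qed
  finally have total: "(LINT r|lborel. LINT s|lborel. f s r)
      = Gamma \<alpha> * Gamma (1 - \<alpha>) * (LINT s:{0..\<tau>}|lebesgue. v s)" .
  have "integrable lborel (\<lambda>r. LINT s|lborel. f s r)"
    by (rule lborel_pair.integrable_snd[OF f_int])
  from has_integral_integral_lborel[OF this]
  have "((\<lambda>r. LINT s|lborel. f s r) has_integral Gamma \<alpha> * Gamma (1 - \<alpha>) * (LINT s:{0..\<tau>}|lebesgue. v s)) UNIV"
    by (simp only: total)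
  moreover have "(LINT s|lborel. f s r) = (if r \<in> {0..\<tau>} then Gamma (1 - \<alpha>) * ((\<tau> - r) powr (\<alpha> - 1) * RL_integral (1 - \<alpha>) v r) else 0)" for r
    by (simp add: outer indicator_def)
  ultimately have "((\<lambda>r. Gamma (1 - \<alpha>) * ((\<tau> - r) powr (\<alpha> - 1) * RL_integral (1 - \<alpha>) v r))
      has_integral Gamma \<alpha> * Gamma (1 - \<alpha>) * (LINT s:{0..\<tau>}|lebesgue. v s)) {0..\<tau>}"
    by (simp only: has_integral_restrict_UNIV)
  then have "((\<lambda>r. (\<tau> - r) powr (\<alpha> - 1) * RL_integral (1 - \<alpha>) v r)
      has_integral Gamma \<alpha> * Gamma (1 - \<alpha>) * (LINT s:{0..\<tau>}|lebesgue. v s) / Gamma (1 - \<alpha>)) {0..\<tau>}"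
    using Gamma_pos by (subst (asm) has_integral_mult_right_iff) auto
  then show ?thesis
    using Gamma_pos by simp
qed

section \<open>Integral representation of the solution\<close>

lemma abs_cont_on_imp_continuous_on:
  assumes x: "abs_cont_on {a..b} x"
  shows "continuous_on {a..b} x"
  unfolding continuous_on_iff
proof (intro ballI allI impI)
  fix t e :: real assume t: "t \<in> {a..b}" and "0 < e"
  obtain \<delta> where "0 < \<delta>" and \<delta>: "\<And>D. D division_of \<Union>D \<Longrightarrow> \<Union>D \<subseteq> {a..b} \<Longrightarrow>
      sum (measure lebesgue) D < \<delta> \<Longrightarrow> (\<Sum>K\<in>D. \<bar>incr x K\<bar>) < e"
    using abs_cont_on_division[OF x \<open>0 < e\<close>] by metis
  have close: "\<bar>x v - x u\<bar> < e" if "u \<le> v" "u \<in> {a..b}" "v \<in> {a..b}" "v - u < \<delta>" for u v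
  proof -
    have "{{u..v}} division_of {u..v}"
      using division_of_self[of u v] that(1) by simp
    then show ?thesis
      using \<delta>[of "{{u..v}}"] that by simp
  qed
  have "dist (x s) (x t) < e" if "s \<in> {a..b}" "dist s t < \<delta>" for s
    using close[of s t] close[of t s] that t by (cases "s \<le> t") (auto simp: dist_real_def abs_minus_commute)
  then show "\<exists>\<delta>>0. \<forall>s\<in>{a..b}. dist s t < \<delta> \<longrightarrow> dist (x s) (x t) < e"
    using \<open>0 < \<delta>\<close> by blast
qed

lemma AC_halfline_imp_continuous_on:
  assumes "x \<in> AC_halfline"
  shows "continuous_on {0..} x"
proof -
  have cont: "continuous_on {0..T} x" if "0 < T" for T
    using assms that abs_cont_on_imp_continuous_on by (simp add: AC_halfline_def)
  have "continuous (at t within {0..}) x" if "0 \<le> t" for t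
  proof -
    have "continuous (at t within {0..t + 1}) x"
      using cont[of "t + 1"] that
      by (simp add: continuous_on_eq_continuous_within)
    moreover have "at t within {0..t + 1} = at t within {0..}"
      by (rule at_within_nhd[of _ "{t - 1<..<t + 1}"]) auto
    ultimately show ?thesis by simp
  qed
  then show ?thesis by (simp add: continuous_on_eq_continuous_within)
qed

text \<open>
  The singular kernel can be divided out, because its reciprocal \<open>(\<tau> - s) powr \<alpha>\<close> is continuous and
  bounded on \<open>{0..\<tau>}\<close>. At \<open>s = \<tau>\<close> the kernel is \<open>0 powr - \<alpha> = 0\<close>, which forces one
  exceptional point.
\<close>
lemma RL_exists_imp_set_integrable:
  assumes "0 < \<alpha>" and ex: "RL_exists (1 - \<alpha>) v \<tau>"
  shows "set_integrable lebesgue {0..\<tau>} v"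
proof (rule absolutely_integrable_spike)
  have "(\<lambda>s. (\<tau> - s) powr \<alpha> * ((\<tau> - s) powr - \<alpha> * v s)) absolutely_integrable_on {0..\<tau>}"
  proof (rule absolutely_integrable_bounded_measurable_product_real)
    have c: "continuous_on {0..\<tau>} (\<lambda>s. (\<tau> - s) powr \<alpha>)"
      using \<open>0 < \<alpha>\<close> by (intro continuous_on_powr' continuous_intros) auto
    show "(\<lambda>s. (\<tau> - s) powr \<alpha>) \<in> borel_measurable (lebesgue_on {0..\<tau>})"
      using c by (intro continuous_imp_measurable_on_sets_lebesgue) auto
    show "bounded ((\<lambda>s. (\<tau> - s) powr \<alpha>) ` {0..\<tau>})"
      using compact_continuous_image[OF c] compact_imp_bounded by blast
    show "set_integrable lebesgue {0..\<tau>} (\<lambda>s. (\<tau> - s) powr - \<alpha> * v s)"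
      using ex by (simp add: RL_exists_def)
  qed simp
  then show "(\<lambda>s. (\<tau> - s) powr \<alpha> * ((\<tau> - s) powr - \<alpha> * v s)) absolutely_integrable_on {0..\<tau>}" .
  show "negligible {\<tau>}" by simp
  show "v s = (\<tau> - s) powr \<alpha> * ((\<tau> - s) powr - \<alpha> * v s)" if "s \<in> {0..\<tau>} - {\<tau>}" for s
    using that by (simp add: mult.assoc[symmetric] powr_add[symmetric])
qed

lemma AC_halfline_increment:
  assumes x: "x \<in> AC_halfline" and "0 < \<tau>"
  shows "(deriv x has_integral x \<tau> - x 0) {0..\<tau>}"
proof (rule fundamental_theorem_of_calculus_abs_cont)
  show ac: "abs_cont_on {0..\<tau>} x" using assms by (simp add: AC_halfline_def)
  show "negligible ({t \<in> {0<..<\<tau>}. \<not> x differentiable (at t)} \<union> {0, \<tau>})"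
    using abs_cont_on_differentiable_ae[OF ac] by (intro negligible_Un) auto
  show "(x has_vector_derivative deriv x t) (at t within {0..\<tau>})"
    if "t \<in> {0..\<tau>} - ({t \<in> {0<..<\<tau>}. \<not> x differentiable (at t)} \<union> {0, \<tau>})" for t
  proof -
    have "x differentiable (at t)" using that by auto
    then have "(x has_real_derivative deriv x t) (at t)"
      by (simp add: DERIV_deriv_iff_real_differentiable)
    then show ?thesis
      by (simp add: has_real_derivative_iff_has_vector_derivative has_vector_derivative_at_within)
  qed
qed (use assms in simp)

text \<open>
  Applying Abel's inversion to the Caputo derivative recovers \<open>x \<tau> - x 0\<close> from an integral of the Caputo
  derivative against \<open>(\<tau> - r) powr (\<alpha> - 1)\<close>. Integration by parts moves the derivative \<open>g\<close> into this
  integral and turns the kernel into \<open>(\<tau> - r) powr \<alpha>\<close>, which is bounded.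
\<close>
theorem caputo_initial_value_representation:
  assumes \<alpha>: "0 < \<alpha>" "\<alpha> < 1" and x: "x \<in> caputo_space \<alpha>"
    and g: "continuous_on {0..} g" "\<And>r. 0 < r \<Longrightarrow> deriv (caputo \<alpha> x) r = g r"
    and init: "(caputo \<alpha> x \<longlongrightarrow> b) (at_right 0)" and "0 < \<tau>"
  shows "x \<tau> = x 0 + (b * \<tau> powr \<alpha> + integral {0..\<tau>} (\<lambda>s. (\<tau> - s) powr \<alpha> * g s)) / Gamma (\<alpha> + 1)"
proof -
  have ac: "x \<in> AC_halfline" and ex: "RL_exists (1 - \<alpha>) (deriv x) \<tau>"
    and diff: "\<And>r. 0 < r \<Longrightarrow> caputo \<alpha> x differentiable at r"
    using x \<open>0 < \<tau>\<close> by (auto simp: caputo_space_def)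
  have int: "set_integrable lebesgue {0..\<tau>} (deriv x)"
    by (rule RL_exists_imp_set_integrable[OF \<alpha>(1) ex])
  have "(LINT s:{0..\<tau>}|lebesgue. deriv x s) = x \<tau> - x 0"
    using has_integral_set_lebesgue[OF int] AC_halfline_increment[OF ac \<open>0 < \<tau>\<close>] has_integral_unique by blast
  then have I: "((\<lambda>r. (\<tau> - r) powr (\<alpha> - 1) * caputo \<alpha> x r) has_integral Gamma \<alpha> * (x \<tau> - x 0)) {0..\<tau>}"
    using Abel_inversion[OF \<alpha> \<open>0 < \<tau>\<close> int] by (simp add: caputo_def)
  (* U extends the Caputo derivative continuously to 0. *)
  define U where "U r = (if r = 0 then b else caputo \<alpha> x r)" for r
  have dU: "(U has_real_derivative g r) (at r)" if "0 < r" for r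
  proof -
    have "(caputo \<alpha> x has_real_derivative g r) (at r)"
      using diff[OF that] g(2)[OF that] by (simp add: DERIV_deriv_iff_real_differentiable[symmetric])
    moreover have "\<forall>\<^sub>F s in nhds r. caputo \<alpha> x s = U s"
      using that by (intro eventually_nhds_in_open[of "{0<..}", THEN eventually_mono]) (auto simp: U_def)
    ultimately show ?thesis
      using DERIV_cong_ev[of r r "caputo \<alpha> x" U "g r" "g r"] by simp
  qed
  have contU: "continuous_on {0..\<tau>} U"
    unfolding continuous_on_eq_continuous_within
  proof
    fix r assume r: "r \<in> {0..\<tau>}"
    show "continuous (at r within {0..\<tau>}) U"
    proof (cases "r = 0")
      case True
      have "(U \<longlongrightarrow> b) (at_right 0)"
        by (rule Lim_transform_eventually[OF init]) (auto simp: U_def eventually_at_filter)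
      then show ?thesis
        using True \<open>0 < \<tau>\<close> by (simp add: continuous_within U_def at_within_Icc_at_right)
    next
      case False
      then show ?thesis
        using dU[of r] r DERIV_isCont continuous_at_imp_continuous_within by fastforce
    qed
  qed
  have contp: "continuous_on {0..\<tau>} (\<lambda>r. (\<tau> - r) powr \<alpha>)"
    using \<alpha> by (intro continuous_on_powr' continuous_intros) auto
  have "((\<lambda>r. (\<tau> - r) powr \<alpha> * g r - \<alpha> * ((\<tau> - r) powr (\<alpha> - 1) * U r)) has_integral
      (\<tau> - \<tau>) powr \<alpha> * U \<tau> - (\<tau> - 0) powr \<alpha> * U 0) {0..\<tau>}"
  proof (rule fundamental_theorem_of_calculus_interior)
    show "continuous_on {0..\<tau>} (\<lambda>r. (\<tau> - r) powr \<alpha> * U r)"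
      by (intro continuous_on_mult contp contU)
    fix r assume r: "r \<in> {0<..<\<tau>}"
    have "((\<lambda>r. (\<tau> - r) powr \<alpha>) has_real_derivative \<alpha> * (\<tau> - r) powr (\<alpha> - 1) * (0 - 1)) (at r)"
      using r by (intro DERIV_chain2[where f="\<lambda>z. z powr \<alpha>"] has_real_derivative_powr DERIV_diff DERIV_const DERIV_ident) auto
    from DERIV_mult[OF this dU, of] r
    have "((\<lambda>r. (\<tau> - r) powr \<alpha> * U r) has_real_derivative
        (\<tau> - r) powr \<alpha> * g r - \<alpha> * ((\<tau> - r) powr (\<alpha> - 1) * U r)) (at r)"
      by (simp add: algebra_simps)
    then show "((\<lambda>r. (\<tau> - r) powr \<alpha> * U r) has_vector_derivative
        (\<tau> - r) powr \<alpha> * g r - \<alpha> * ((\<tau> - r) powr (\<alpha> - 1) * U r)) (at r)"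
      by (simp add: has_real_derivative_iff_has_vector_derivative)
  qed (use \<open>0 < \<tau>\<close> in simp)
  then have parts: "((\<lambda>r. (\<tau> - r) powr \<alpha> * g r - \<alpha> * ((\<tau> - r) powr (\<alpha> - 1) * U r)) has_integral - (b * \<tau> powr \<alpha>)) {0..\<tau>}"
    by (simp add: U_def mult.commute)
  have "((\<lambda>r. (\<tau> - r) powr (\<alpha> - 1) * U r) has_integral Gamma \<alpha> * (x \<tau> - x 0)) {0..\<tau>}"
    by (rule has_integral_spike[OF negligible_sing[of 0] _ I]) (simp add: U_def)
  then have "((\<lambda>r. \<alpha> * ((\<tau> - r) powr (\<alpha> - 1) * U r)) has_integral \<alpha> * (Gamma \<alpha> * (x \<tau> - x 0))) {0..\<tau>}"
    by (rule has_integral_mult_right)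
  from has_integral_add[OF parts this]
  have "((\<lambda>r. (\<tau> - r) powr \<alpha> * g r) has_integral - (b * \<tau> powr \<alpha>) + \<alpha> * (Gamma \<alpha> * (x \<tau> - x 0))) {0..\<tau>}"
    by simp
  then have "integral {0..\<tau>} (\<lambda>r. (\<tau> - r) powr \<alpha> * g r) = - (b * \<tau> powr \<alpha>) + \<alpha> * Gamma \<alpha> * (x \<tau> - x 0)"
    by (simp add: integral_unique)
  also have "\<alpha> * Gamma \<alpha> = Gamma (\<alpha> + 1)"
    using \<alpha> by (intro Gamma_plus1[symmetric]) (auto dest: nonpos_Ints_nonpos)
  finally have "x \<tau> - x 0 = (b * \<tau> powr \<alpha> + integral {0..\<tau>} (\<lambda>s. (\<tau> - s) powr \<alpha> * g s)) / Gamma (\<alpha> + 1)"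
    using Gamma_real_pos[OF add_pos_pos[OF \<alpha>(1) zero_less_one]]
    by (subst nonzero_eq_divide_eq) (simp_all add: mult.commute)
  then show ?thesis by simp
qed

section \<open>Growth estimates\<close>

text \<open>
  After division by \<open>\<tau> powr \<alpha>\<close> the kernel is \<open>(1 - s / \<tau>) powr \<alpha>\<close>, which lies between $0$ and $1$ and tends to $1$ for
  each fixed \<open>s\<close>; dominated convergence applies.
\<close>
lemma fractional_integral_asymptotics:
  fixes g :: "real \<Rightarrow> real"
  assumes "0 < \<alpha>" and g: "set_integrable lebesgue {0..} g"
  shows "((\<lambda>\<tau>. integral {0..\<tau>} (\<lambda>s. (\<tau> - s) powr \<alpha> * g s) / \<tau> powr \<alpha>) \<longlongrightarrow> integral {0..} g) at_top"
proof -
  define G where "G s = indicator {0..} s * g s" for s :: real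
  have G: "integrable lebesgue G" using g by (simp add: G_def[abs_def] set_integrable_def)
  define h where "h \<tau> s = (indicator {0..\<tau>} s * (1 - s / \<tau>) powr \<alpha>) * G s" for \<tau> s :: real
  have m: "h \<tau> \<in> borel_measurable lebesgue" for \<tau>
    unfolding h_def[abs_def]
  proof (rule borel_measurable_times)
    show "(\<lambda>s. indicator {0..\<tau>} s * (1 - s / \<tau>) powr \<alpha>) \<in> borel_measurable lebesgue"
      by (rule measurable_completion) simp
    show "G \<in> borel_measurable lebesgue" using G by simp
  qed
  have bound: "norm (h \<tau> s) \<le> norm (G s)" if "0 < \<tau>" for \<tau> s
  proof -
    have "\<bar>indicator {0..\<tau>} s * (1 - s / \<tau>) powr \<alpha>\<bar> \<le> 1"
      using that \<open>0 < \<alpha>\<close> by (auto simp: indicator_def intro!: powr_le1)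
    then show ?thesis
      by (simp add: h_def abs_mult mult_left_le_one_le)
  qed
  have lim: "((\<lambda>\<tau>. h \<tau> s) \<longlongrightarrow> G s) at_top" for s
  proof (cases "0 \<le> s")
    case True
    have "((\<lambda>\<tau>. s / \<tau>) \<longlongrightarrow> 0) at_top"
      by (intro tendsto_divide_0[OF tendsto_const] filterlim_at_top_imp_at_infinity filterlim_ident)
    then have "((\<lambda>\<tau>. (1 - s / \<tau>) powr \<alpha> * G s) \<longlongrightarrow> (1 - 0) powr \<alpha> * G s) at_top"
      by (intro tendsto_intros) auto
    moreover have "\<forall>\<^sub>F \<tau> in at_top. (1 - s / \<tau>) powr \<alpha> * G s = h \<tau> s"
      using eventually_ge_at_top[of s] by eventually_elim (use True in \<open>simp add: h_def\<close>)
    ultimately show ?thesis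
      by (simp add: tendsto_cong)
  next
    case False
    then show ?thesis by (simp add: h_def G_def)
  qed
  have "((\<lambda>\<tau>. LINT s|lebesgue. h \<tau> s) \<longlongrightarrow> (LINT s|lebesgue. G s)) at_top"
  proof (rule integral_dominated_convergence_at_top)
    show "integrable lebesgue (\<lambda>s. norm (G s))" using G by simp
    show "\<forall>\<^sub>F \<tau> in at_top. AE s in lebesgue. norm (h \<tau> s) \<le> norm (G s)"
      using eventually_gt_at_top[of 0] by eventually_elim (simp only: bound AE_I2)
  qed (use m lim G in auto)
  moreover have "(LINT s|lebesgue. G s) = integral {0..} g"
    using set_lebesgue_integral_eq_integral(2)[OF g] by (simp add: set_lebesgue_integral_def G_def[abs_def])
  moreover have "\<forall>\<^sub>F \<tau> in at_top. (LINT s|lebesgue. h \<tau> s) = integral {0..\<tau>} (\<lambda>s. (\<tau> - s) powr \<alpha> * g s) / \<tau> powr \<alpha>"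
    using eventually_gt_at_top[of 0]
  proof eventually_elim
    case (elim \<tau>)
    have h_eq: "h \<tau> = (\<lambda>s. indicator {0..\<tau>} s *\<^sub>R ((1 - s / \<tau>) powr \<alpha> * g s))"
      by (auto simp: h_def G_def indicator_def)
    have "integrable lebesgue (h \<tau>)"
      by (rule Bochner_Integration.integrable_bound[OF G m]) (simp only: bound[OF elim] AE_I2)
    then have "set_integrable lebesgue {0..\<tau>} (\<lambda>s. (1 - s / \<tau>) powr \<alpha> * g s)"
      by (simp only: set_integrable_def h_eq)
    then have "(LINT s|lebesgue. h \<tau> s) = integral {0..\<tau>} (\<lambda>s. (1 - s / \<tau>) powr \<alpha> * g s)"
      using set_lebesgue_integral_eq_integral(2) by (simp only: set_lebesgue_integral_def h_eq)
    also have "\<dots> = integral {0..\<tau>} (\<lambda>s. (1 / \<tau> powr \<alpha>) * ((\<tau> - s) powr \<alpha> * g s))"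
    proof (rule Henstock_Kurzweil_Integration.integral_cong)
      fix s assume s: "s \<in> {0..\<tau>}"
      have "1 - s / \<tau> = (\<tau> - s) / \<tau>" using elim by (simp add: field_simps)
      then show "(1 - s / \<tau>) powr \<alpha> * g s = (1 / \<tau> powr \<alpha>) * ((\<tau> - s) powr \<alpha> * g s)"
        using s elim by (simp add: powr_divide)
    qed
    also have "\<dots> = integral {0..\<tau>} (\<lambda>s. (\<tau> - s) powr \<alpha> * g s) / \<tau> powr \<alpha>"
      by (subst integral_mult_right) simp
    finally show ?case .
  qed
  ultimately show ?thesis by (simp add: tendsto_cong)
qed

text \<open>
  The product of the right-hand side with \<open>exp (- integral {a..t} k)\<close> has a derivative that is not
  positive, hence does not exceed its initial value \<open>K\<close>.
\<close>
lemma Gronwall: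
  fixes k y :: "real \<Rightarrow> real"
  assumes k: "continuous_on {a..b} k" "\<And>t. t \<in> {a..b} \<Longrightarrow> 0 \<le> k t" and y: "continuous_on {a..b} y"
    and le: "\<And>t. t \<in> {a..b} \<Longrightarrow> y t \<le> K + integral {a..t} (\<lambda>s. k s * y s)" and "a \<le> b"
  shows "y b \<le> K * exp (integral {a..b} k)"
proof -
  define G where "G t = K + integral {a..t} (\<lambda>s. k s * y s)" for t
  define Z where "Z t = G t * exp (- integral {a..t} k)" for t
  have ky: "continuous_on {a..b} (\<lambda>s. k s * y s)"
    using k(1) y by (intro continuous_intros)
  have "Z b \<le> Z a"
  proof (rule DERIV_nonpos_imp_decreasing_open[OF \<open>a \<le> b\<close>])
    show "continuous_on {a..b} Z"
      unfolding Z_def G_def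
      by (intro continuous_intros indefinite_integral_continuous_1 integrable_continuous_real ky k(1))
    fix t assume t: "a < t" "t < b"
    then have at: "at t within {a..b} = at t" by (intro at_within_interior) simp
    have dI: "((\<lambda>t. integral {a..t} k) has_real_derivative k t) (at t)"
      using integral_has_real_derivative[OF k(1), of t] t at by simp
    have dG: "(G has_real_derivative k t * y t) (at t)"
      unfolding G_def using integral_has_real_derivative[OF ky, of t] t at
      by (auto intro!: derivative_eq_intros)
    have "(Z has_real_derivative (k t * y t - k t * G t) * exp (- integral {a..t} k)) (at t)"
      unfolding Z_def by (rule derivative_eq_intros dG dI refl)+ (simp add: algebra_simps)
    moreover have "k t * y t \<le> k t * G t"
      using le[of t] k(2)[of t] t by (intro mult_left_mono) (auto simp: G_def)
    ultimately show "\<exists>d. (Z has_real_derivative d) (at t) \<and> d \<le> 0"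
      by (intro exI conjI) (auto simp: mult_nonpos_nonneg)
  qed
  then have "G b * exp (- integral {a..b} k) \<le> K"
    by (simp add: Z_def G_def)
  then have "G b \<le> K * exp (integral {a..b} k)"
    by (simp add: exp_minus field_simps)
  then show ?thesis using le[of b] \<open>a \<le> b\<close> by (simp add: G_def)
qed

text \<open>
  The scaling property of \<open>\<phi>\<close> is used twice: to pull the factor \<open>v\<close> out of \<open>\<phi>\<close>, and, with the argument and
  the factor equal, to show that \<open>\<phi>\<close> grows at most linearly. Thus a linear Gronwall inequality is
  enough for a nonlinear equation. The argument is shifted by $1$ because the linear bound
  \<open>\<phi> u \<le> u * \<phi> 1\<close> needs \<open>1 \<le> u\<close>; the summand \<open>\<phi> 0\<close> takes care of \<open>w = 0\<close>, since the scaling property only concerns positive arguments.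
\<close>
lemma Phi_class_linear_bound:
  assumes phi: "\<phi> \<in> Phi_class" "0 \<le> \<phi> 0" and "1 \<le> v" "0 \<le> w"
  shows "\<phi> w \<le> v * ((\<phi> 0 + \<phi> 1) * (1 + w / v))"
proof (cases "w = 0")
  case True
  have "0 < \<phi> 1" using phi by (simp add: Phi_class_def)
  then have "\<phi> w \<le> 1 * (\<phi> 0 + \<phi> 1)" using True by simp
  also have "\<dots> \<le> v * (\<phi> 0 + \<phi> 1)"
    using assms \<open>0 < \<phi> 1\<close> by (intro mult_right_mono) auto
  finally show ?thesis using True by simp
next
  case False
  then have "0 < w" "0 < v" "0 < w / v" using assms by auto
  have *: "\<phi> u / c \<le> \<phi> (u / c)" if "0 < u" "1 \<le> c" for u c
    using phi that by (simp add: Phi_class_def)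
  have "\<phi> (w / v) \<le> \<phi> (1 + w / v)"
    using phi(1) \<open>0 < w / v\<close> by (auto simp: Phi_class_def intro: mono_onD)
  also have "\<dots> \<le> (1 + w / v) * \<phi> 1"
    using *[of "1 + w / v" "1 + w / v"] \<open>0 < w / v\<close> by (simp add: field_simps)
  also have "\<dots> \<le> (1 + w / v) * (\<phi> 0 + \<phi> 1)"
    using phi(2) \<open>0 < w / v\<close> by (intro mult_left_mono) auto
  finally have "v * \<phi> (w / v) \<le> v * ((\<phi> 0 + \<phi> 1) * (1 + w / v))"
    using \<open>0 < v\<close> by (simp add: mult.commute)
  moreover have "\<phi> w \<le> v * \<phi> (w / v)"
    using *[of w v] \<open>0 < w\<close> \<open>0 < v\<close> assms by (simp add: field_simps)
  ultimately show ?thesis by linarith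
qed

section \<open>Asymptotics of the solution\<close>

theorem theorem4p1:
  fixes \<alpha> b1 b2 :: real
    and f :: "real \<Rightarrow> real \<Rightarrow> real"
    and P \<phi> x :: "real \<Rightarrow> real"
  assumes alpha: "0 < \<alpha>" "\<alpha> < 1"
    and f_cont: "continuous_on ({0..} \<times> UNIV) (\<lambda>(\<tau>, y). f \<tau> y)"
    and f_weighted: "\<And>y. y \<in> AC_halfline \<Longrightarrow> (\<lambda>\<tau>. f \<tau> (y \<tau>)) \<in> C_weighted (1 - \<alpha>)"
    and P: "continuous_on {0..} P" "\<And>\<tau>. 0 \<le> \<tau> \<Longrightarrow> 0 \<le> P \<tau>"
    and phi: "continuous_on {0..} \<phi>" "\<And>w. 0 \<le> w \<Longrightarrow> 0 \<le> \<phi> w"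
    and f_bound: "\<And>\<tau> y. 0 \<le> \<tau> \<Longrightarrow> \<bar>f \<tau> y\<bar> \<le> \<phi> \<bar>y\<bar> * P \<tau>"
    and P_int: "set_integrable lebesgue {1..} (\<lambda>s. s powr \<alpha> * P s)"
    and phi_class: "\<phi> \<in> Phi_class"
    and x_space: "x \<in> caputo_space \<alpha>"
    and x_eq: "\<And>\<tau>. 0 < \<tau> \<Longrightarrow> deriv (caputo \<alpha> x) \<tau> = f \<tau> (x \<tau>)"
    and x_init: "x 0 = b1"
    and caputo_init: "(caputo \<alpha> x \<longlongrightarrow> b2) (at_right 0)"
  shows "\<exists>a::real. ((\<lambda>\<tau>. x \<tau> / \<tau> powr \<alpha>) \<longlongrightarrow> a) at_top"
proof -
  define c where "c = 1 / Gamma (\<alpha> + 1)"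
  have "0 < c" using alpha by (simp add: c_def Gamma_real_pos)
  define g where "g s = f s (x s)" for s
  have ac: "x \<in> AC_halfline" using x_space by (simp add: caputo_space_def)
  have contx: "continuous_on {0..} x" by (rule AC_halfline_imp_continuous_on[OF ac])
  have contg: "continuous_on {0..} g"
  proof -
    have "continuous_on {0..} (\<lambda>s. (s, x s))"
      by (intro continuous_intros contx)
    from continuous_on_compose2[OF f_cont this] show ?thesis
      by (simp add: g_def[abs_def] image_subset_iff)
  qed
  have contg': "continuous_on {a..b} g" if "0 \<le> a" for a b
    by (rule continuous_on_subset[OF contg]) (use that in auto)
  have contga: "continuous_on {a..b} (\<lambda>s. \<bar>g s\<bar>)" if "0 \<le> a" for a b
    by (intro continuous_intros contg' that)
  have rep: "x \<tau> = b1 + c * (b2 * \<tau> powr \<alpha> + integral {0..\<tau>} (\<lambda>s. (\<tau> - s) powr \<alpha> * g s))" if "0 < \<tau>" for \<tau>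
    using caputo_initial_value_representation[OF alpha x_space contg _ caputo_init that] x_eq x_init
    by (simp add: g_def c_def)
  define h where "h s = s powr \<alpha> * P s" for s
  have conth: "continuous_on {1..b} h" for b
    unfolding h_def using alpha
    by (intro continuous_intros continuous_on_subset[OF P(1)]) auto
  have h_nonneg: "0 \<le> h s" if "1 \<le> s" for s
    using P(2) that by (simp add: h_def)
  have h_int: "h integrable_on {1..}"
    using set_lebesgue_integral_eq_integral(1)[OF P_int] by (simp add: h_def[abs_def])
  define C where "C = \<phi> 0 + \<phi> 1"
  have "0 < C" using phi(2)[of 0] phi_class by (auto simp: C_def Phi_class_def intro: add_nonneg_pos)
  (* Since \<phi> grows at most linearly, C * y s bounds \<phi> (\<bar>x s\<bar>) / s powr \<alpha> for s \<ge> 1. *)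
  define y where "y \<tau> = 1 + \<bar>x \<tau>\<bar> / \<tau> powr \<alpha>" for \<tau>
  have conty: "continuous_on {1..b} y" for b
    unfolding y_def by (intro continuous_intros continuous_on_subset[OF contx]) auto
  have g_le: "\<bar>g s\<bar> \<le> C * (h s * y s)" if "1 \<le> s" for s
  proof -
    have "\<bar>g s\<bar> \<le> \<phi> \<bar>x s\<bar> * P s" using f_bound[of s "x s"] that by (simp add: g_def)
    also have "\<phi> \<bar>x s\<bar> \<le> s powr \<alpha> * (C * y s)"
      unfolding C_def y_def
      using Phi_class_linear_bound[OF phi_class phi(2)[OF order_refl], of "s powr \<alpha>" "\<bar>x s\<bar>"] that alpha
      by (simp add: ge_one_powr_ge_zero)
    finally show ?thesis
      using P(2)[of s] that by (simp add: h_def mult_ac mult_right_mono)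
  qed
  (* For \<tau> \<ge> 1, K bounds 1 plus all terms of the representation, divided by \<tau> powr \<alpha>, except the integral
     beyond 1. The split is at 1 because the scaling of \<phi> by s powr \<alpha> requires s powr \<alpha> \<ge> 1. *)
  define K where "K = 1 + \<bar>b1\<bar> + c * (\<bar>b2\<bar> + integral {0..1} (\<lambda>s. \<bar>g s\<bar>))"
  have "0 < K"
    using \<open>0 < c\<close> by (auto simp: K_def intro!: add_pos_nonneg mult_nonneg_nonneg add_nonneg_nonneg integral_nonneg integrable_continuous_real contga)
  have y_le: "y \<tau> \<le> K + integral {1..\<tau>} (\<lambda>s. (c * C * h s) * y s)" if "1 \<le> \<tau>" for \<tau>
  proof -
    have contp: "continuous_on {0..\<tau>} (\<lambda>s. (\<tau> - s) powr \<alpha> * g s)"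
      using alpha by (intro continuous_on_mult continuous_on_powr' continuous_intros contg') auto
    have p1: "1 \<le> \<tau> powr \<alpha>" using that alpha by (simp add: ge_one_powr_ge_zero)
    define J where "J = integral {0..\<tau>} (\<lambda>s. (\<tau> - s) powr \<alpha> * g s)"
    have "\<bar>J\<bar> \<le> integral {0..\<tau>} (\<lambda>s. \<tau> powr \<alpha> * \<bar>g s\<bar>)"
      unfolding J_def real_norm_def[symmetric]
    proof (rule integral_norm_bound_integral)
      show "norm ((\<tau> - s) powr \<alpha> * g s) \<le> \<tau> powr \<alpha> * norm (g s)" if "s \<in> {0..\<tau>}" for s
        using that alpha by (auto simp: abs_mult intro!: mult_right_mono powr_mono2)
    qed (auto intro!: integrable_continuous_real contp continuous_intros contg' simp del: real_norm_def)
    also have "\<dots> = \<tau> powr \<alpha> * integral {0..\<tau>} (\<lambda>s. \<bar>g s\<bar>)"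
      by (rule integral_mult_right)
    finally have J: "\<bar>J\<bar> \<le> \<tau> powr \<alpha> * integral {0..\<tau>} (\<lambda>s. \<bar>g s\<bar>)" .
    have "integral {0..1} (\<lambda>s. \<bar>g s\<bar>) + integral {1..\<tau>} (\<lambda>s. \<bar>g s\<bar>) = integral {0..\<tau>} (\<lambda>s. \<bar>g s\<bar>)"
      using that by (intro Henstock_Kurzweil_Integration.integral_combine integrable_continuous_real contga) auto
    moreover have "integral {1..\<tau>} (\<lambda>s. \<bar>g s\<bar>) \<le> integral {1..\<tau>} (\<lambda>s. C * (h s * y s))"
      by (intro integral_le integrable_continuous_real contga continuous_intros conth conty) (auto simp: g_le)
    ultimately have "integral {0..\<tau>} (\<lambda>s. \<bar>g s\<bar>) \<le> integral {0..1} (\<lambda>s. \<bar>g s\<bar>) + integral {1..\<tau>} (\<lambda>s. C * (h s * y s))"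
      by linarith
    then have G: "c * integral {0..\<tau>} (\<lambda>s. \<bar>g s\<bar>)
        \<le> c * integral {0..1} (\<lambda>s. \<bar>g s\<bar>) + integral {1..\<tau>} (\<lambda>s. (c * C * h s) * y s)"
      using \<open>0 < c\<close> mult_left_mono[of _ _ c] by (fastforce simp: algebra_simps simp flip: integral_mult_right)
    have "\<bar>x \<tau>\<bar> = \<bar>b1 + c * (b2 * \<tau> powr \<alpha>) + c * J\<bar>"
      using rep[of \<tau>] that by (simp add: J_def algebra_simps)
    also have "\<dots> \<le> \<bar>b1\<bar> + \<bar>c * (b2 * \<tau> powr \<alpha>)\<bar> + \<bar>c * J\<bar>" by linarith
    also have "\<dots> = \<bar>b1\<bar> * 1 + c * \<bar>b2\<bar> * \<tau> powr \<alpha> + c * \<bar>J\<bar>"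
      using \<open>0 < c\<close> by (simp add: abs_mult)
    also have "\<dots> \<le> \<bar>b1\<bar> * \<tau> powr \<alpha> + c * \<bar>b2\<bar> * \<tau> powr \<alpha> + c * (\<tau> powr \<alpha> * integral {0..\<tau>} (\<lambda>s. \<bar>g s\<bar>))"
      using J p1 \<open>0 < c\<close> by (intro add_mono mult_left_mono) auto
    also have "\<dots> = (\<bar>b1\<bar> + c * \<bar>b2\<bar> + c * integral {0..\<tau>} (\<lambda>s. \<bar>g s\<bar>)) * \<tau> powr \<alpha>"
      by (simp add: algebra_simps)
    finally have "\<bar>x \<tau>\<bar> / \<tau> powr \<alpha> \<le> \<bar>b1\<bar> + c * \<bar>b2\<bar> + c * integral {0..\<tau>} (\<lambda>s. \<bar>g s\<bar>)"
      using p1 by (subst pos_divide_le_eq) auto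
    then show ?thesis
      using G by (simp add: y_def K_def algebra_simps)
  qed
  define M where "M = K * exp (c * C * integral {1..} h)"
  have y_bounded: "y \<tau> \<le> M" if "1 \<le> \<tau>" for \<tau>
  proof -
    have "y \<tau> \<le> K * exp (integral {1..\<tau>} (\<lambda>s. c * C * h s))"
    proof (rule Gronwall)
      show "continuous_on {1..\<tau>} (\<lambda>s. c * C * h s)" by (intro continuous_intros conth)
      show "0 \<le> c * C * h t" if "t \<in> {1..\<tau>}" for t
        using that h_nonneg \<open>0 < c\<close> \<open>0 < C\<close> by simp
      show "y t \<le> K + integral {1..t} (\<lambda>s. c * C * h s * y s)" if "t \<in> {1..\<tau>}" for t
        using y_le that by simp
    qed (use that conty in auto)
    also have "integral {1..\<tau>} (\<lambda>s. c * C * h s) = c * C * integral {1..\<tau>} h"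
      by (rule integral_mult_right)
    also have "K * exp (c * C * integral {1..\<tau>} h) \<le> M"
    proof -
      have "integral {1..\<tau>} h \<le> integral {1..} h"
        by (intro integral_subset_le integrable_continuous_real conth h_int) (auto simp: h_nonneg)
      then show ?thesis
        using \<open>0 < K\<close> \<open>0 < c\<close> \<open>0 < C\<close> by (simp add: M_def)
    qed
    finally show ?thesis .
  qed
  have "g absolutely_integrable_on ({0..1} \<union> {1..})"
  proof (rule set_integrable_Un)
    show "g absolutely_integrable_on {0..1}"
      by (rule absolutely_integrable_continuous_real[OF contg']) simp
    show "g absolutely_integrable_on {1..}"
    proof (rule measurable_bounded_by_integrable_imp_absolutely_integrable)
      show "g \<in> borel_measurable (lebesgue_on {1..})"
        by (intro continuous_imp_measurable_on_sets_lebesgue continuous_on_subset[OF contg]) auto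
      show "(\<lambda>s. C * M * h s) integrable_on {1..}"
        using h_int by (rule integrable_on_mult_right)
      show "norm (g s) \<le> C * M * h s" if "s \<in> {1..}" for s
      proof -
        have "\<bar>g s\<bar> \<le> C * (h s * y s)" using g_le that by simp
        also have "\<dots> \<le> C * (h s * M)"
          using y_bounded[of s] h_nonneg[of s] \<open>0 < C\<close> that by (intro mult_left_mono) auto
        finally show ?thesis by (simp add: mult_ac)
      qed
    qed simp
  qed auto
  also have "{0..1} \<union> {1..} = {0::real..}" by auto
  finally have g_int: "set_integrable lebesgue {0..} g" .
  (* With g integrable on the half-line, the limit can be read off from the representation formula. *)
  have "((\<lambda>\<tau>. \<tau> powr - \<alpha>) \<longlongrightarrow> 0) at_top"
    using alpha by (intro tendsto_neg_powr filterlim_ident) auto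
  then have "((\<lambda>\<tau>. b1 * \<tau> powr - \<alpha> + c * (b2 + integral {0..\<tau>} (\<lambda>s. (\<tau> - s) powr \<alpha> * g s) / \<tau> powr \<alpha>))
      \<longlongrightarrow> b1 * 0 + c * (b2 + integral {0..} g)) at_top"
    by (intro tendsto_intros fractional_integral_asymptotics[OF alpha(1) g_int])
  moreover have "\<forall>\<^sub>F \<tau> in at_top. b1 * \<tau> powr - \<alpha> + c * (b2 + integral {0..\<tau>} (\<lambda>s. (\<tau> - s) powr \<alpha> * g s) / \<tau> powr \<alpha>)
      = x \<tau> / \<tau> powr \<alpha>"
    using eventually_gt_at_top[of 0]
    by eventually_elim (simp add: rep powr_minus field_simps)
  ultimately have "((\<lambda>\<tau>. x \<tau> / \<tau> powr \<alpha>) \<longlongrightarrow> b1 * 0 + c * (b2 + integral {0..} g)) at_top"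
    by (rule Lim_transform_eventually)
  then show ?thesis ..
qed

end
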